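(* Let $E$ be locally complete and let $G\subset E'$ be a linear subspace which determines boundedness. Let $(T^{E}_{m},T^{\mathbb{K}}_{m})_{m\in\mathcal{M}}$ be a defining family for $(\mathcal{FV},E)$ and a strong, consistent family for $(\mathcal{FW},E)$, where $\mathcal{FV}(\Omega)$ is a Banach space with $\mathcal{V}=(\nu_{1,1,m})_{m\in M_1}$ whose closed unit ball $B_{\mathcal{FV}(\Omega)}$ is a compact subset of $\mathcal{FW}(\Omega)$, and let $U$ be a set of uniqueness for $\mathcal{FV}(\Omega)$. Then the map \[ R_{U,G}\colon S\bigl(\{u\in\mathcal{FW}(\Omega)\varepsilon E\;|\;u(B_{\mathcal{FV}(\Omega)}^{\circ\mathcal{FW}(\Omega)'})\text{ is bounded in }E\}\bigr)\to\mathcal{FV}_G(U,E),\quad f\mapsto(T^E_m(f)(x))_{(m,x)\in U}, \] is surjective.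
   Context: $\mathbb{K}\in\{\mathbb{R},\mathbb{C}\}$; $E$ is a non-trivial locally convex Hausdorff space over $\mathbb{K}$ with a directed fundamental system of seminorms $(p_\alpha)_{\alpha\in\mathfrak{A}}$ (for $E=\mathbb{K}$: $\{|\cdot|\}$); $E'$ its dual. $E$ is locally complete if for every closed bounded absolutely convex $D\subset E$ the space $\bigcup_n nD$ normed by the gauge of $D$ is a Banach space. $G\subset E'$ determines boundedness if every $\sigma(E,G)$-bounded subset of $E$ is bounded. Weighted function spaces: given non-empty sets $\Omega,J,L$, non-empty sets $(M_l)_{l\in L}$ and a family $\mathcal{V}=((\nu_{j,l,m})_{m\in M_l})_{j\in J,l\in L}$ of functions $\nu_{j,l,m}\colon\Omega\to[0,\infty)$ such that for all $x\in\Omega$, $l\in L$ there is $j$ with $\nu_{j,l,m}(x)>0$ for all $m\in M_l$; $\mathcal{M}_{\mathrm{top}}:=\bigcup_lM_l$, sets $\mathcal{M}_0,\mathcal{M}_r$, the three pairwise disjoint, $\mathcal{M}$ their union; non-empty sets $(\omega_m)_{m\in\mathcal{M}}$ with $\Omega\subset\omega_m$ for $m\in\mathcal{M}_{\mathrm{top}}$; for $F\in\{E,\mathbb{K}\}$ linear maps $T^F_m\colon\operatorname{dom}T^F_m\subset F^\Omega\to F^{\omega_m}$. $\mathcal{FV}(\Omega,F)$ is the set of $f\in\bigcap_{m\in\mathcal{M}}\operatorname{dom}T^F_m\cap\bigcap_{m\in\mathcal{M}_0}\ker T^F_m$ with $|f|_{j,l,\alpha}:=\sup_{x\in\Omega,m\in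 M_l}p_\alpha(T^F_m(f)(x))\nu_{j,l,m}(x)<\infty$ for all $j,l,\alpha$, with these seminorms; $\mathcal{FV}(\Omega):=\mathcal{FV}(\Omega,\mathbb{K})$; $T^F_{m,x}(f):=T^F_m(f)(x)$. Such a space is a dom-space if its seminorms are directed and, in the scalar case, point evaluations $\delta_x$ are continuous. If $\mathcal{FV}(\Omega)$ and $\mathcal{FV}(\Omega,E)$ are dom-spaces built from the same data with operators $T^{\mathbb{K}}_m$ resp. $T^E_m$, $(T^E_m,T^{\mathbb{K}}_m)_{m\in\mathcal{M}}$ is called a defining family for $(\mathcal{FV},E)$. $\mathcal{FW}(\Omega)$, $\mathcal{FW}(\Omega,E)$ denote spaces of the same type built from the same $\Omega$, index set $\mathcal{M}$, sets $\omega_m$ and operators, but with another family of weights $\mathcal{W}$. $\mathcal{FW}(\Omega)\varepsilon E$ is the space of continuous linear maps $\mathcal{FW}(\Omega)'_\kappa\to E$ ($\kappa$: uniform convergence on absolutely convex compact sets), and $S(u)(x):=u(\delta_x)$. The family is consistent for $(\mathcal{FW},E)$ if for all $u\in\mathcal{FW}(\Omega)\varepsilon E$, $m\in\mathcal{M}$, $x\in\omega_m$: $S(u)\in\operatorname{dom}T^E_m$, $T^{\mathbb{K}}_{m,x}|_{\mathcal{FW}(\Omega)}\in\mathcal{FW}(\Omega)'$ and $T^E_m(S(u))(x)=u(T^{\mathbb{K}}_{m,x})$; strong for $(\mathcal{FW},E)$ if for all $e'\in E'$, $f\in\mathcal{FW}(\Omega,E)$, $m$: $e'\circ f\in\operatorname{dom}T^{\mathbb{K}}_m$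 and $T^{\mathbb{K}}_m(e'\circ f)=e'\circ T^E_m(f)$ on $\omega_m$. $B_{\mathcal{FV}(\Omega)}^{\circ\mathcal{FW}(\Omega)'}:=\{y'\in\mathcal{FW}(\Omega)': |y'(z)|\le1\ \forall z\in B_{\mathcal{FV}(\Omega)}\}$. $U\subset\bigcup_m\{m\}\times\omega_m$ is a set of uniqueness for $\mathcal{FV}(\Omega)$ if $T^{\mathbb{K}}_{m,x}\in\mathcal{FV}(\Omega)'$ for $(m,x)\in U$ and $f\in\mathcal{FV}(\Omega)$ with $T^{\mathbb{K}}_m(f)(x)=0$ for all $(m,x)\in U$ is $0$. $\mathcal{FV}_G(U,E)$ is the set of $f\colon U\to E$ such that for each $e'\in G$ there is $f_{e'}\in\mathcal{FV}(\Omega)$ with $T^{\mathbb{K}}_m(f_{e'})(x)=e'(f(m,x))$ for all $(m,x)\in U$. Under the hypotheses the map $R_{U,G}$ takes values in $\mathcal{FV}_G(U,E)$. *)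

theory Defs
  imports "HOL-Analysis.Analysis" "HOL-Library.Function_Algebras"
begin

text \<open>Functions on a set, identified with functions on the whole type vanishing outside it.\<close>
definition ext0 :: "'x set \<Rightarrow> ('x \<Rightarrow> 'v::zero) set" where
  "ext0 S = {f. \<forall>x. x \<notin> S \<longrightarrow> f x = 0}"

definition fscale :: "('k \<Rightarrow> 'v \<Rightarrow> 'v) \<Rightarrow> 'k \<Rightarrow> ('x \<Rightarrow> 'v) \<Rightarrow> ('x \<Rightarrow> 'v)" where
  "fscale sm c f = (\<lambda>x. sm c (f x))"

definition subspace_sm :: "('k \<Rightarrow> 'v \<Rightarrow> 'v) \<Rightarrow> 'v::ab_group_add set \<Rightarrow> bool" where
  "subspace_sm sm X \<longleftrightarrow> 0 \<in> X \<and> (\<forall>x\<in>X. \<forall>y\<in>X. x + y \<in> X) \<and> (\<forall>c. \<forall>x\<in>X. sm c x \<in> X)"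

definition seminorm_on :: "('k::real_normed_field \<Rightarrow> 'v \<Rightarrow> 'v) \<Rightarrow> 'v::ab_group_add set \<Rightarrow> ('v \<Rightarrow> real) \<Rightarrow> bool" where
  "seminorm_on sm X q \<longleftrightarrow> (\<forall>x\<in>X. 0 \<le> q x) \<and> (\<forall>x\<in>X. \<forall>y\<in>X. q (x + y) \<le> q x + q y)
      \<and> (\<forall>c. \<forall>x\<in>X. q (sm c x) = norm c * q x)"

definition directed_sn :: "'v set \<Rightarrow> 'i set \<Rightarrow> ('i \<Rightarrow> 'v \<Rightarrow> real) \<Rightarrow> bool" where
  "directed_sn X I s \<longleftrightarrow> (\<forall>i\<in>I. \<forall>j\<in>I. \<exists>k\<in>I. \<exists>C. \<forall>x\<in>X. max (s i x) (s j x) \<le> C * s k x)"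

definition sn_topology :: "'v::ab_group_add set \<Rightarrow> 'i set \<Rightarrow> ('i \<Rightarrow> 'v \<Rightarrow> real) \<Rightarrow> 'v topology" where
  "sn_topology X I s = topology (\<lambda>V. V \<subseteq> X \<and> (\<forall>f\<in>V. \<exists>F \<epsilon>. finite F \<and> F \<subseteq> I \<and> 0 < \<epsilon>
        \<and> {g\<in>X. \<forall>i\<in>F. s i (g - f) < \<epsilon>} \<subseteq> V))"

definition bounded_sn :: "'i set \<Rightarrow> ('i \<Rightarrow> 'v \<Rightarrow> real) \<Rightarrow> 'v set \<Rightarrow> bool" where
  "bounded_sn I s B \<longleftrightarrow> (\<forall>i\<in>I. bdd_above (s i ` B))"

definition absconv :: "('k::real_normed_field \<Rightarrow> 'v \<Rightarrow> 'v) \<Rightarrow> 'v::ab_group_add set \<Rightarrow> bool" where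
  "absconv sm D \<longleftrightarrow> D \<noteq> {} \<and> (\<forall>x\<in>D. \<forall>y\<in>D. \<forall>a b. norm a + norm b \<le> 1 \<longrightarrow> sm a x + sm b y \<in> D)"

definition dual :: "('k::real_normed_field \<Rightarrow> 'v \<Rightarrow> 'v) \<Rightarrow> 'v::ab_group_add set \<Rightarrow> 'i set
     \<Rightarrow> ('i \<Rightarrow> 'v \<Rightarrow> real) \<Rightarrow> ('v \<Rightarrow> 'k) set" where
  "dual sm X I s = {\<phi>. (\<forall>f. f \<notin> X \<longrightarrow> \<phi> f = 0)
      \<and> (\<forall>f\<in>X. \<forall>g\<in>X. \<phi> (f + g) = \<phi> f + \<phi> g) \<and> (\<forall>c. \<forall>f\<in>X. \<phi> (sm c f) = c * \<phi> f)
      \<and> (\<exists>i\<in>I. \<exists>C. \<forall>f\<in>X. norm (\<phi> f) \<le> C * s i f)}"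

definition restr :: "'v set \<Rightarrow> ('v \<Rightarrow> 'k::zero) \<Rightarrow> ('v \<Rightarrow> 'k)" where
  "restr X \<phi> = (\<lambda>f. if f \<in> X then \<phi> f else 0)"

definition banach_sn :: "'v::ab_group_add set \<Rightarrow> ('v \<Rightarrow> real) \<Rightarrow> bool" where
  "banach_sn X q \<longleftrightarrow> (\<forall>f\<in>X. q f = 0 \<longrightarrow> f = 0)
     \<and> (\<forall>u. (\<forall>n. u n \<in> X) \<and> (\<forall>\<epsilon>>0. \<exists>N. \<forall>n\<ge>N. \<forall>k\<ge>N. q (u n - u k) < \<epsilon>)
           \<longrightarrow> (\<exists>g\<in>X. (\<lambda>n. q (u n - g)) \<longlonglongrightarrow> 0))"

definition lc_space :: "('k::real_normed_field \<Rightarrow> 'e::ab_group_add \<Rightarrow> 'e) \<Rightarrow> 'a set \<Rightarrow> ('a \<Rightarrow> 'e \<Rightarrow> real) \<Rightarrow> bool" where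
  "lc_space sm A p \<longleftrightarrow> vector_space sm \<and> (\<exists>x::'e. x \<noteq> 0) \<and> A \<noteq> {}
      \<and> (\<forall>\<alpha>\<in>A. seminorm_on sm UNIV (p \<alpha>)) \<and> directed_sn UNIV A p
      \<and> (\<forall>x. x \<noteq> 0 \<longrightarrow> (\<exists>\<alpha>\<in>A. p \<alpha> x \<noteq> 0))"

definition gauge :: "('k::real_normed_field \<Rightarrow> 'e \<Rightarrow> 'e) \<Rightarrow> 'e set \<Rightarrow> 'e \<Rightarrow> real" where
  "gauge sm D x = Inf {t::real. 0 < t \<and> (\<exists>d\<in>D. x = sm (of_real t) d)}"

definition span_ED :: "('k::real_normed_field \<Rightarrow> 'e \<Rightarrow> 'e) \<Rightarrow> 'e set \<Rightarrow> 'e set" where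
  "span_ED sm D = (\<Union>n::nat. sm (of_nat n) ` D)"

definition locally_complete :: "('k::real_normed_field \<Rightarrow> 'e::ab_group_add \<Rightarrow> 'e) \<Rightarrow> 'a set \<Rightarrow> ('a \<Rightarrow> 'e \<Rightarrow> real) \<Rightarrow> bool" where
  "locally_complete sm A p \<longleftrightarrow> (\<forall>D. closedin (sn_topology UNIV A p) D \<and> bounded_sn A p D \<and> absconv sm D
       \<longrightarrow> banach_sn (span_ED sm D) (gauge sm D))"

definition determines_boundedness :: "'a set \<Rightarrow> ('a \<Rightarrow> 'e \<Rightarrow> real) \<Rightarrow> ('e \<Rightarrow> 'k::real_normed_field) set \<Rightarrow> bool" where
  "determines_boundedness A p G \<longleftrightarrow> (\<forall>B. (\<forall>e'\<in>G. bdd_above ((\<lambda>x. norm (e' x)) ` B)) \<longrightarrow> bounded_sn A p B)"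

definition fun_subspace :: "('e \<Rightarrow> 'k::real_normed_field) set \<Rightarrow> bool" where
  "fun_subspace G \<longleftrightarrow> (\<lambda>_. 0) \<in> G \<and> (\<forall>f\<in>G. \<forall>g\<in>G. (\<lambda>x. f x + g x) \<in> G) \<and> (\<forall>c. \<forall>f\<in>G. (\<lambda>x. c * f x) \<in> G)"

text \<open>Data: Omega, J, L, M_l, weights nu, the index set M, M_0 and the sets omega_m.
  M_top is the union of the M_l, M_r is M without M_top and M_0.\<close>
definition weight_data :: "'x set \<Rightarrow> 'j set \<Rightarrow> 'l set \<Rightarrow> ('l \<Rightarrow> 'm set) \<Rightarrow> ('j \<Rightarrow> 'l \<Rightarrow> 'm \<Rightarrow> 'x \<Rightarrow> real)
     \<Rightarrow> 'm set \<Rightarrow> 'm set \<Rightarrow> ('m \<Rightarrow> 'x set) \<Rightarrow> bool" where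
  "weight_data \<Omega> J L Ml \<nu> M M0 \<omega> \<longleftrightarrow> \<Omega> \<noteq> {} \<and> J \<noteq> {} \<and> L \<noteq> {} \<and> (\<forall>l\<in>L. Ml l \<noteq> {})
     \<and> (\<forall>j l m. \<forall>x\<in>\<Omega>. 0 \<le> \<nu> j l m x)
     \<and> (\<forall>x\<in>\<Omega>. \<forall>l\<in>L. \<exists>j\<in>J. \<forall>m\<in>Ml l. 0 < \<nu> j l m x)
     \<and> (\<Union>l\<in>L. Ml l) \<subseteq> M \<and> M0 \<subseteq> M \<and> (\<Union>l\<in>L. Ml l) \<inter> M0 = {}
     \<and> (\<forall>m\<in>M. \<omega> m \<noteq> {}) \<and> (\<forall>m\<in>(\<Union>l\<in>L. Ml l). \<Omega> \<subseteq> \<omega> m)"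

definition op_data :: "('k::real_normed_field \<Rightarrow> 'v::ab_group_add \<Rightarrow> 'v) \<Rightarrow> 'x set \<Rightarrow> 'm set \<Rightarrow> ('m \<Rightarrow> 'x set)
     \<Rightarrow> ('m \<Rightarrow> ('x \<Rightarrow> 'v) set) \<Rightarrow> ('m \<Rightarrow> ('x \<Rightarrow> 'v) \<Rightarrow> ('x \<Rightarrow> 'v)) \<Rightarrow> bool" where
  "op_data sm \<Omega> M \<omega> Dm T \<longleftrightarrow> (\<forall>m\<in>M. Dm m \<subseteq> ext0 \<Omega> \<and> subspace_sm (fscale sm) (Dm m)
      \<and> (\<forall>f\<in>Dm m. T m f \<in> ext0 (\<omega> m))
      \<and> (\<forall>f\<in>Dm m. \<forall>g\<in>Dm m. \<forall>x\<in>\<omega> m. T m (f + g) x = T m f x + T m g x)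
      \<and> (\<forall>c. \<forall>f\<in>Dm m. \<forall>x\<in>\<omega> m. T m (fscale sm c f) x = sm c (T m f x)))"

text \<open>The space FV(Omega,F); q are the seminorms of F (for F = K: the modulus, indexed by unit).\<close>
definition FVspace :: "'x set \<Rightarrow> 'j set \<Rightarrow> 'l set \<Rightarrow> ('l \<Rightarrow> 'm set) \<Rightarrow> ('j \<Rightarrow> 'l \<Rightarrow> 'm \<Rightarrow> 'x \<Rightarrow> real)
     \<Rightarrow> 'm set \<Rightarrow> 'm set \<Rightarrow> ('m \<Rightarrow> 'x set) \<Rightarrow> ('m \<Rightarrow> ('x \<Rightarrow> 'v) set) \<Rightarrow> ('m \<Rightarrow> ('x \<Rightarrow> 'v) \<Rightarrow> ('x \<Rightarrow> 'v))
     \<Rightarrow> 'a set \<Rightarrow> ('a \<Rightarrow> 'v \<Rightarrow> real) \<Rightarrow> ('x \<Rightarrow> 'v::zero) set" where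
  "FVspace \<Omega> J L Ml \<nu> M M0 \<omega> Dm T A q = {f. f \<in> ext0 \<Omega> \<and> (\<forall>m\<in>M. f \<in> Dm m)
      \<and> (\<forall>m\<in>M0. \<forall>x\<in>\<omega> m. T m f x = 0)
      \<and> (\<forall>j\<in>J. \<forall>l\<in>L. \<forall>\<alpha>\<in>A. bdd_above {q \<alpha> (T m f x) * \<nu> j l m x | x m. x \<in> \<Omega> \<and> m \<in> Ml l})}"

definition wsn :: "'x set \<Rightarrow> ('l \<Rightarrow> 'm set) \<Rightarrow> ('j \<Rightarrow> 'l \<Rightarrow> 'm \<Rightarrow> 'x \<Rightarrow> real)
     \<Rightarrow> ('m \<Rightarrow> ('x \<Rightarrow> 'v) \<Rightarrow> ('x \<Rightarrow> 'v)) \<Rightarrow> ('a \<Rightarrow> 'v \<Rightarrow> real) \<Rightarrow> 'j \<times> 'l \<times> 'a \<Rightarrow> ('x \<Rightarrow> 'v) \<Rightarrow> real" where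
  "wsn \<Omega> Ml \<nu> T q = (\<lambda>(j,l,\<alpha>) f. Sup {q \<alpha> (T m f x) * \<nu> j l m x | x m. x \<in> \<Omega> \<and> m \<in> Ml l})"

abbreviation FVK where
  "FVK \<Omega> J L Ml \<nu> M M0 \<omega> domK TK \<equiv> FVspace \<Omega> J L Ml \<nu> M M0 \<omega> domK TK (UNIV::unit set) (\<lambda>_ z. norm z)"

abbreviation snK where
  "snK \<Omega> Ml \<nu> TK \<equiv> wsn \<Omega> Ml \<nu> TK (\<lambda>(_::unit) z. norm z)"

definition delta :: "('x \<Rightarrow> 'k) set \<Rightarrow> 'x \<Rightarrow> (('x \<Rightarrow> 'k) \<Rightarrow> 'k::zero)" where
  "delta X x = restr X (\<lambda>f. f x)"

definition defining_family ::
  "('k::real_normed_field \<Rightarrow> 'e::ab_group_add \<Rightarrow> 'e) \<Rightarrow> 'a set \<Rightarrow> ('a \<Rightarrow> 'e \<Rightarrow> real)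
   \<Rightarrow> 'x set \<Rightarrow> 'j set \<Rightarrow> 'l set \<Rightarrow> ('l \<Rightarrow> 'm set) \<Rightarrow> ('j \<Rightarrow> 'l \<Rightarrow> 'm \<Rightarrow> 'x \<Rightarrow> real)
   \<Rightarrow> 'm set \<Rightarrow> 'm set \<Rightarrow> ('m \<Rightarrow> 'x set)
   \<Rightarrow> ('m \<Rightarrow> ('x \<Rightarrow> 'e) set) \<Rightarrow> ('m \<Rightarrow> ('x \<Rightarrow> 'e) \<Rightarrow> ('x \<Rightarrow> 'e))
   \<Rightarrow> ('m \<Rightarrow> ('x \<Rightarrow> 'k) set) \<Rightarrow> ('m \<Rightarrow> ('x \<Rightarrow> 'k) \<Rightarrow> ('x \<Rightarrow> 'k)) \<Rightarrow> bool" where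
  "defining_family sm A p \<Omega> J L Ml \<nu> M M0 \<omega> domE TE domK TK \<longleftrightarrow>
     weight_data \<Omega> J L Ml \<nu> M M0 \<omega> \<and> op_data sm \<Omega> M \<omega> domE TE \<and> op_data (*) \<Omega> M \<omega> domK TK
   \<and> directed_sn (FVK \<Omega> J L Ml \<nu> M M0 \<omega> domK TK) (J \<times> L \<times> UNIV) (snK \<Omega> Ml \<nu> TK)
   \<and> (\<forall>x\<in>\<Omega>. delta (FVK \<Omega> J L Ml \<nu> M M0 \<omega> domK TK) x
          \<in> dual (fscale (*)) (FVK \<Omega> J L Ml \<nu> M M0 \<omega> domK TK) (J \<times> L \<times> UNIV) (snK \<Omega> Ml \<nu> TK))
   \<and> directed_sn (FVspace \<Omega> J L Ml \<nu> M M0 \<omega> domE TE A p) (J \<times> L \<times> A) (wsn \<Omega> Ml \<nu> TE p)"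

definition acx_compacts :: "'x set \<Rightarrow> ('x \<Rightarrow> 'k::real_normed_field) set \<Rightarrow> 'i set \<Rightarrow> ('i \<Rightarrow> ('x \<Rightarrow> 'k) \<Rightarrow> real)
     \<Rightarrow> ('x \<Rightarrow> 'k) set set" where
  "acx_compacts \<Omega> X I s = {K. K \<subseteq> X \<and> absconv (fscale (*)) K \<and> compactin (sn_topology X I s) K}"

text \<open>X epsilon E: continuous linear maps X'_kappa -> E.\<close>
definition eps_prod :: "('k::real_normed_field \<Rightarrow> 'e::ab_group_add \<Rightarrow> 'e) \<Rightarrow> 'a set \<Rightarrow> ('a \<Rightarrow> 'e \<Rightarrow> real)
     \<Rightarrow> 'x set \<Rightarrow> ('x \<Rightarrow> 'k) set \<Rightarrow> 'i set \<Rightarrow> ('i \<Rightarrow> ('x \<Rightarrow> 'k) \<Rightarrow> real) \<Rightarrow> ((('x \<Rightarrow> 'k) \<Rightarrow> 'k) \<Rightarrow> 'e) set" where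
  "eps_prod sm A p \<Omega> X I s = {u.
      (\<forall>y. y \<notin> dual (fscale (*)) X I s \<longrightarrow> u y = 0)
    \<and> (\<forall>y\<in>dual (fscale (*)) X I s. \<forall>z\<in>dual (fscale (*)) X I s. u (\<lambda>f. y f + z f) = u y + u z)
    \<and> (\<forall>c. \<forall>y\<in>dual (fscale (*)) X I s. u (\<lambda>f. c * y f) = sm c (u y))
    \<and> (\<forall>\<alpha>\<in>A. \<exists>K\<in>acx_compacts \<Omega> X I s. \<exists>C. \<forall>y\<in>dual (fscale (*)) X I s.
            p \<alpha> (u y) \<le> C * Sup ((\<lambda>f. norm (y f)) ` K))}"

definition Sop :: "'x set \<Rightarrow> ('x \<Rightarrow> 'k::zero) set \<Rightarrow> ((('x \<Rightarrow> 'k) \<Rightarrow> 'k) \<Rightarrow> 'e::zero) \<Rightarrow> ('x \<Rightarrow> 'e)" where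
  "Sop \<Omega> X u = (\<lambda>x. if x \<in> \<Omega> then u (delta X x) else 0)"

definition consistent_family ::
  "('k::real_normed_field \<Rightarrow> 'e::ab_group_add \<Rightarrow> 'e) \<Rightarrow> 'a set \<Rightarrow> ('a \<Rightarrow> 'e \<Rightarrow> real)
   \<Rightarrow> 'x set \<Rightarrow> 'j set \<Rightarrow> 'l set \<Rightarrow> ('l \<Rightarrow> 'm set) \<Rightarrow> ('j \<Rightarrow> 'l \<Rightarrow> 'm \<Rightarrow> 'x \<Rightarrow> real)
   \<Rightarrow> 'm set \<Rightarrow> 'm set \<Rightarrow> ('m \<Rightarrow> 'x set)
   \<Rightarrow> ('m \<Rightarrow> ('x \<Rightarrow> 'e) set) \<Rightarrow> ('m \<Rightarrow> ('x \<Rightarrow> 'e) \<Rightarrow> ('x \<Rightarrow> 'e))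
   \<Rightarrow> ('m \<Rightarrow> ('x \<Rightarrow> 'k) set) \<Rightarrow> ('m \<Rightarrow> ('x \<Rightarrow> 'k) \<Rightarrow> ('x \<Rightarrow> 'k)) \<Rightarrow> bool" where
  "consistent_family sm A p \<Omega> J L Ml \<nu> M M0 \<omega> domE TE domK TK \<longleftrightarrow>
     defining_family sm A p \<Omega> J L Ml \<nu> M M0 \<omega> domE TE domK TK
   \<and> (let X = FVK \<Omega> J L Ml \<nu> M M0 \<omega> domK TK; I = J \<times> L \<times> (UNIV::unit set); s = snK \<Omega> Ml \<nu> TK in
      \<forall>u\<in>eps_prod sm A p \<Omega> X I s. \<forall>m\<in>M. \<forall>x\<in>\<omega> m.
         Sop \<Omega> X u \<in> domE m \<and> restr X (\<lambda>f. TK m f x) \<in> dual (fscale (*)) X I s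
         \<and> TE m (Sop \<Omega> X u) x = u (restr X (\<lambda>f. TK m f x)))"

definition strong_family ::
  "('k::real_normed_field \<Rightarrow> 'e::ab_group_add \<Rightarrow> 'e) \<Rightarrow> 'a set \<Rightarrow> ('a \<Rightarrow> 'e \<Rightarrow> real)
   \<Rightarrow> 'x set \<Rightarrow> 'j set \<Rightarrow> 'l set \<Rightarrow> ('l \<Rightarrow> 'm set) \<Rightarrow> ('j \<Rightarrow> 'l \<Rightarrow> 'm \<Rightarrow> 'x \<Rightarrow> real)
   \<Rightarrow> 'm set \<Rightarrow> 'm set \<Rightarrow> ('m \<Rightarrow> 'x set)
   \<Rightarrow> ('m \<Rightarrow> ('x \<Rightarrow> 'e) set) \<Rightarrow> ('m \<Rightarrow> ('x \<Rightarrow> 'e) \<Rightarrow> ('x \<Rightarrow> 'e))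
   \<Rightarrow> ('m \<Rightarrow> ('x \<Rightarrow> 'k) set) \<Rightarrow> ('m \<Rightarrow> ('x \<Rightarrow> 'k) \<Rightarrow> ('x \<Rightarrow> 'k)) \<Rightarrow> bool" where
  "strong_family sm A p \<Omega> J L Ml \<nu> M M0 \<omega> domE TE domK TK \<longleftrightarrow>
     defining_family sm A p \<Omega> J L Ml \<nu> M M0 \<omega> domE TE domK TK
   \<and> (\<forall>e'\<in>dual sm UNIV A p. \<forall>f\<in>FVspace \<Omega> J L Ml \<nu> M M0 \<omega> domE TE A p. \<forall>m\<in>M.
        e' \<circ> f \<in> domK m \<and> (\<forall>x\<in>\<omega> m. TK m (e' \<circ> f) x = e' (TE m f x)))"

definition uniqueness_set :: "'m set \<Rightarrow> ('m \<Rightarrow> 'x set) \<Rightarrow> ('m \<Rightarrow> ('x \<Rightarrow> 'k) \<Rightarrow> ('x \<Rightarrow> 'k::real_normed_field))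
     \<Rightarrow> ('x \<Rightarrow> 'k) set \<Rightarrow> 'i set \<Rightarrow> ('i \<Rightarrow> ('x \<Rightarrow> 'k) \<Rightarrow> real) \<Rightarrow> ('m \<times> 'x) set \<Rightarrow> bool" where
  "uniqueness_set M \<omega> TK X I s U \<longleftrightarrow> U \<subseteq> Sigma M \<omega>
     \<and> (\<forall>(m,x)\<in>U. restr X (\<lambda>f. TK m f x) \<in> dual (fscale (*)) X I s)
     \<and> (\<forall>f\<in>X. (\<forall>(m,x)\<in>U. TK m f x = 0) \<longrightarrow> f = 0)"

definition FVG :: "('m \<Rightarrow> ('x \<Rightarrow> 'k) \<Rightarrow> ('x \<Rightarrow> 'k)) \<Rightarrow> ('x \<Rightarrow> 'k) set \<Rightarrow> ('m \<times> 'x) set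
     \<Rightarrow> ('e \<Rightarrow> 'k) set \<Rightarrow> ('m \<times> 'x \<Rightarrow> 'e::zero) set" where
  "FVG TK X U G = {F. (\<forall>mx. mx \<notin> U \<longrightarrow> F mx = 0)
      \<and> (\<forall>e'\<in>G. \<exists>g\<in>X. \<forall>(m,x)\<in>U. TK m g x = e' (F (m,x)))}"

definition Rmap :: "('m \<times> 'x) set \<Rightarrow> ('m \<Rightarrow> ('x \<Rightarrow> 'e) \<Rightarrow> ('x \<Rightarrow> 'e::zero)) \<Rightarrow> ('x \<Rightarrow> 'e) \<Rightarrow> ('m \<times> 'x \<Rightarrow> 'e)" where
  "Rmap U TE f = (\<lambda>(m,x). if (m,x) \<in> U then TE m f x else 0)"

text \<open>Weights of the Banach space FV(Omega): V = (nu_{1,1,m})_{m in M_1}, J = L = {1} (modelled by unit).\<close>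
definition unitw :: "('m \<Rightarrow> 'x \<Rightarrow> real) \<Rightarrow> unit \<Rightarrow> unit \<Rightarrow> 'm \<Rightarrow> 'x \<Rightarrow> real" where
  "unitw \<nu> = (\<lambda>_ _ m x. \<nu> m x)"

definition unit_ball :: "'v set \<Rightarrow> ('v \<Rightarrow> real) \<Rightarrow> 'v set" where
  "unit_ball X q = {f\<in>X. q f \<le> 1}"

definition polar_in :: "'v set \<Rightarrow> ('v \<Rightarrow> 'k::real_normed_field) set \<Rightarrow> ('v \<Rightarrow> 'k) set" where
  "polar_in B D = {y\<in>D. \<forall>z\<in>B. norm (y z) \<le> 1}"

end

theory Submission
  imports Defs
begin

text \<open>
  Write \<open>B\<close> for the unit ball of \<open>FV\<close> and \<open>Y\<close> for the dual of \<open>FW\<close>. Both inclusions rest on one Helly-type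
  theorem: since \<open>B\<close> is compact and absolutely convex, finitely or infinitely many equations \<open>y g = c y\<close> with
  \<open>y \<in> Y\<close> have a common solution \<open>g \<in> B\<close> as soon as \<open>|\<Sum> a y * c y| \<le> sup B |\<Sum> a y * y|\<close> for all finite
  linear combinations. It makes every functional on \<open>Y\<close> that is bounded on the polar of \<open>B\<close> an evaluation at
  an element of \<open>FV\<close>, so \<open>e' \<circ> u\<close> yields the scalar extension of \<open>e' \<circ> F\<close>.

  For surjectivity let \<open>fe e'\<close> be the scalar extension of \<open>e' \<circ> F\<close>, and look for \<open>u y \<in> E\<close> with
  \<open>e' (u y) = y (fe e')\<close> for all \<open>e' \<in> G\<close>. Such a vector is unique because \<open>G\<close> separates points, and it
  exists for \<open>y\<close> in the span of the functionals given by \<open>U\<close>. The set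
  \<open>D = {x. |e' x| \<le> \<parallel>fe e'\<parallel> for all e' \<in> G}\<close> is a closed bounded disk, so local completeness makes existence stable
  under limits uniform on \<open>B\<close>; the Helly-type theorem and uniqueness on \<open>U\<close> show that the span is dense.

  The Helly-type theorem needs Hilbert space geometry of the scalars, hence the embedding of an arbitrary
  real normed field into the complex numbers (Ostrowski).
\<close>

section \<open>Real normed fields\<close>

text \<open>The norm grows quadratically in \<open>(a, b)\<close>, so a minimum over a large closed
  ball is global. The competitors are the monic real quadratics that are non-negative on the reals,
  evaluated at \<open>z\<close>.\<close>

lemma of_real_quadratic_min:
  fixes z :: "'k::real_normed_field"
  shows "\<exists>a b. \<forall>a' b'. norm ((z - of_real a)\<^sup>2 + of_real (b\<^sup>2)) \<le> norm ((z - of_real a')\<^sup>2 + of_real (b'\<^sup>2))"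
proof -
  define f where "f = (\<lambda>(a,b). norm ((z - of_real a)\<^sup>2 + of_real (b\<^sup>2) :: 'k))"
  define R where "R = 2 * norm z + 1"
  have R: "R \<ge> 1" by (simp add: R_def)
  have low: "f (a,b) \<ge> (norm (a,b))\<^sup>2 - 2 * norm (a,b) * norm z - (norm z)\<^sup>2" for a b :: real
  proof -
    have n: "(norm (a,b))\<^sup>2 = a\<^sup>2 + b\<^sup>2" by (simp add: norm_Pair)
    have a: "\<bar>a\<bar> \<le> norm (a,b)" using norm_fst_le[of a b] by simp
    have "of_real (a\<^sup>2 + b\<^sup>2) = ((z - of_real a)\<^sup>2 + of_real (b\<^sup>2)) + (2 * of_real a * z - z\<^sup>2)"
      by (simp add: power2_eq_square algebra_simps)
    then have "norm (of_real (a\<^sup>2 + b\<^sup>2) :: 'k) \<le> f (a,b) + norm (2 * of_real a * z - z\<^sup>2)"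
      unfolding f_def by (metis norm_triangle_ineq case_prod_conv)
    moreover have "norm (2 * of_real a * z - z\<^sup>2) \<le> 2 * \<bar>a\<bar> * norm z + (norm z)\<^sup>2"
      by (rule order_trans[OF norm_triangle_ineq4]) (simp add: norm_mult norm_power)
    moreover have "norm (of_real (a\<^sup>2 + b\<^sup>2) :: 'k) = a\<^sup>2 + b\<^sup>2" by (simp only: norm_of_real) simp
    moreover have "2 * \<bar>a\<bar> * norm z \<le> 2 * norm (a,b) * norm z" using a by (simp add: mult_right_mono)
    ultimately show ?thesis using n by linarith
  qed
  \<comment> \<open>Outside radius \<open>3*R\<close> the bound \<open>low\<close> gives at least
    \<open>5*R^2\<close>, which exceeds \<open>(norm z)^2\<close> and hence the value at the
    origin.\<close>
  have "\<exists>w\<in>cball 0 (3*R). \<forall>v\<in>cball 0 (3*R). f w \<le> f v"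
    by (rule continuous_attains_inf) (use R in \<open>auto simp: f_def case_prod_unfold intro!: continuous_intros\<close>)
  then obtain w where w: "\<And>v. norm v \<le> 3*R \<Longrightarrow> f w \<le> f v"
    by (simp only: Ball_def Bex_def mem_cball_0) blast
  have "f w \<le> f v" for v
  proof (cases "norm v \<le> 3 * R")
    case False
    obtain a b where v: "v = (a,b)" by (cases v)
    have *: "norm v * norm v \<ge> 3*R * norm v" using False R by (intro mult_right_mono) auto
    have 1: "(norm v)\<^sup>2 - 2 * norm v * norm z = norm v * norm v - (R - 1) * norm v"
      by (simp add: R_def power2_eq_square algebra_simps)
    have 2: "2 * R * norm v \<ge> 2 * R * (3 * R)" using False R by (intro mult_left_mono) auto
    have "f 0 \<le> (norm z)\<^sup>2" by (simp add: f_def zero_prod_def norm_power)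
    moreover have "f w \<le> f 0" using w[of 0] R by simp
    moreover have "(norm z)\<^sup>2 \<le> R\<^sup>2" by (rule power_mono) (auto simp: R_def)
    moreover have "R*R \<ge> 0" "norm v \<ge> 0" by auto
    ultimately show ?thesis using low[of a b, folded v] 1 2 * unfolding power2_eq_square left_diff_distrib by linarith
  qed (use w in auto)
  then show ?thesis by (cases w) (fastforce simp: f_def)
qed

text \<open>\<open>x\<^sup>4\<^sup>j + 2c x\<^sup>2\<^sup>je\<^sup>2\<^sup>j + e\<^sup>4\<^sup>j\<close> splits as a product of two terms of the same shape, so the bound
  for quadratics in \<open>h\<close> passes to exponents \<open>2\<^sup>k\<close>; this replaces the factorisation over roots of unity.\<close>
lemma norm_dyadic_ge:
  fixes h :: "'k::real_normed_field"
  assumes m: "m \<ge> 0"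
    and base: "\<And>c. \<bar>c\<bar> \<le> 1 \<Longrightarrow> m\<^sup>2 \<le> norm (h\<^sup>2 + of_real (2 * c * e) * h + of_real (e\<^sup>2))"
    and c: "\<bar>c\<bar> \<le> 1"
  shows "m ^ (2 * 2^k) \<le> norm (h ^ (2 * 2^k) + of_real (2 * c * e ^ (2^k)) * h ^ (2^k) + of_real (e ^ (2 * 2^k)))"
  using c
proof (induction k arbitrary: c)
  case 0
  show ?case using base[OF 0] by (simp add: power2_eq_square)
next
  case (Suc k)
  \<comment> \<open>Half-angle choice: \<open>(x^2 + y^2)^2 - 4*d^2*x^2*y^2\<close> has middle
    coefficient \<open>2 - 4*d^2 = 2*c\<close>, so the wanted polynomial splits as a difference of
    squares.\<close>
  define d where "d = sqrt ((1 - c) / 2)"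
  have d: "\<bar>d\<bar> \<le> 1" "\<bar>-d\<bar> \<le> 1" using Suc.prems by (auto simp: d_def)
  have d2: "d\<^sup>2 = (1 - c) / 2" using Suc.prems by (simp add: d_def)
  define x where "x = h ^ (2^k)"
  define y :: 'k where "y = of_real (e ^ (2^k))"
  define D :: 'k where "D = of_real d"
  have c': "(of_real c :: 'k) = 1 - 2 * D\<^sup>2"
    unfolding D_def of_real_power[symmetric] d2 by (simp add: diff_divide_distrib)
  have *: "h ^ (2 * 2^Suc k) + of_real (2 * c * e ^ (2^Suc k)) * h ^ (2^Suc k) + of_real (e ^ (2 * 2^Suc k))
     = (h ^ (2 * 2^k) + of_real (2 * d * e ^ (2^k)) * h ^ (2^k) + of_real (e ^ (2 * 2^k)))
     * (h ^ (2 * 2^k) + of_real (2 * (-d) * e ^ (2^k)) * h ^ (2^k) + of_real (e ^ (2 * 2^k)))"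
  proof -
    have p: "h ^ (2 * 2^k) = x^2" "h ^ (2^k) = x" "h ^ (2 * 2^Suc k) = x^4" "h ^ (2^Suc k) = x^2"
      by (simp_all add: x_def flip: power_mult) (simp_all add: mult.commute mult.assoc)
    have q: "(of_real (e ^ (2 * 2^k)) :: 'k) = y^2" "(of_real (e ^ (2 * 2^Suc k)) :: 'k) = y^4" "(of_real (e ^ (2^k)) :: 'k) = y"
       "(of_real (e ^ (2^Suc k)) :: 'k) = y^2"
      by (simp_all add: y_def flip: power_mult) (simp_all add: mult.commute mult.assoc)
    show ?thesis unfolding of_real_mult p q c' of_real_minus D_def[symmetric] of_real_numeral
      by (simp add: power2_eq_square power4_eq_xxxx algebra_simps)
  qed
  have "m ^ (2 * 2^Suc k) = m ^ (2 * 2^k) * m ^ (2 * 2^k)" by (simp flip: power_add)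
  also have "\<dots> \<le> norm (h ^ (2 * 2^Suc k) + of_real (2 * c * e ^ (2^Suc k)) * h ^ (2^Suc k) + of_real (e ^ (2 * 2^Suc k)))"
    unfolding * norm_mult by (intro mult_mono Suc.IH d) (use m in auto)
  finally show ?case .
qed

text \<open>Iterating \<open>h^(2n) - e^(2n) = (h^n - e^n) * (h^n + e^n)\<close> ends with
  \<open>(h - e) * (h + e)\<close>. Every factor except \<open>h + e\<close> is at least the
  matching power of \<open>m\<close>, the later plus factors by \<open>norm_dyadic_ge\<close> with
  \<open>c = 0\<close>.\<close>

lemma norm_dyadic_diff_ge:
  fixes h :: "'k::real_normed_field"
  assumes m: "m \<ge> 0" and minus: "m \<le> norm (h - of_real e)"
    and base: "\<And>c. \<bar>c\<bar> \<le> 1 \<Longrightarrow> m\<^sup>2 \<le> norm (h\<^sup>2 + of_real (2 * c * e) * h + of_real (e\<^sup>2))"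
  shows "norm (h + of_real e) * m ^ (2 * 2^k - 1) \<le> norm (h ^ (2 * 2^k) - of_real (e ^ (2 * 2^k)))"
proof (induction k)
  case 0
  have "h\<^sup>2 - of_real (e\<^sup>2) = (h + of_real e) * (h - of_real e)" by (simp add: power2_eq_square algebra_simps)
  then show ?case using minus by (simp add: norm_mult mult_left_mono)
next
  case (Suc k)
  define n :: nat where "n = 2 * 2^k"
  have n: "2 * 2 ^ Suc k = n + n" "n \<ge> 1" by (auto simp: n_def)
  have "norm (h + of_real e) * m ^ (2 * 2^Suc k - 1) = (norm (h + of_real e) * m ^ (n - 1)) * m ^ n"
    using n by (simp flip: power_add)
  also have "\<dots> \<le> norm (h ^ n - of_real (e ^ n)) * norm (h ^ n + of_real (e ^ n))"
    using norm_dyadic_ge[OF m base, of 0 k] Suc.IH m by (intro mult_mono) (auto simp: n_def)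
  also have "\<dots> = norm (h ^ (2 * 2^Suc k) - of_real (e ^ (2 * 2^Suc k)))"
    unfolding n norm_mult[symmetric] by (simp add: algebra_simps power_add)
  finally show ?case .
qed

text \<open>Ostrowski-type argument: the least norm among these quadratics is shown to be zero.
  Every element is thus algebraic of degree at most two over the reals.\<close>

lemma real_normed_field_quadratic:
  fixes z :: "'k::real_normed_field"
  shows "\<exists>a b. (z - of_real a)\<^sup>2 + of_real (b\<^sup>2) = 0"
proof -
  define f where "f = (\<lambda>a b. norm ((z - of_real a)\<^sup>2 + of_real (b\<^sup>2) :: 'k))"
  obtain a b0 where min: "\<And>a' b'. f a b0 \<le> f a' b'" using of_real_quadratic_min[of z] unfolding f_def by blast
  define m where "m = f a b0"
  define X where "X = z - of_real a"
  \<comment> \<open>A completed square with remainder \<open>r \<ge> 0\<close> belongs to the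
    minimised family, with \<open>b = sqrt r\<close>.\<close>
  have quad: "m \<le> norm ((X - of_real t)\<^sup>2 + of_real r)" if "r \<ge> 0" for t r
    using min[of "a + t" "sqrt r"] that by (simp add: f_def m_def X_def algebra_simps del: of_real_power)
  have "m = 0"
  proof (rule ccontr)
    assume "m \<noteq> 0"
    then have m: "m > 0" by (simp add: m_def f_def less_le)
    define e where "e = m / 2"
    have e: "0 < e" "e < m" using m by (auto simp: e_def)
    text \<open>A minimiser stays a minimiser when \<open>b\<^sup>2\<close> grows by \<open>e\<close>, contradicting growth at infinity.\<close>
    have step: "norm (X\<^sup>2 + of_real (r + e)) = m" if r: "r \<ge> 0" and eq: "norm (X\<^sup>2 + of_real r) = m" for r
    proof -
      define h where "h = X\<^sup>2 + of_real r"
      have hm: "norm h = m" using eq by (simp add: h_def)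
      \<comment> \<open>For \<open>r \<ge> e\<close> this element is again in the minimised family;
        otherwise it splits into two real linear factors, each of squared norm at least
        \<open>m\<close>.\<close>
      have minus: "m \<le> norm (h - of_real e)"
      proof (cases "r \<ge> e")
        case True
        then show ?thesis using quad[of "r - e" 0] by (simp add: h_def algebra_simps)
      next
        case False
        define c where "c = sqrt (e - r)"
        have c2: "c\<^sup>2 = e - r" using False by (simp add: c_def)
        have "of_real (c\<^sup>2) = (of_real e - of_real r :: 'k)" by (simp add: c2)
        then have *: "h - of_real e = (X - of_real c) * (X - of_real (- c))"
          by (simp add: h_def power2_eq_square algebra_simps)
        have le: "m \<le> (norm (X - of_real t))\<^sup>2" for t using quad[of 0 t] by (simp add: norm_power)
        have "m * m \<le> (norm (X - of_real c))\<^sup>2 * (norm (X - of_real (- c)))\<^sup>2"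
          using mult_mono[OF le le, of c "- c"] m by simp
        then have "m\<^sup>2 \<le> (norm (h - of_real e))\<^sup>2"
          by (simp only: * norm_mult power_mult_distrib power2_eq_square mult_ac)
        then show ?thesis by (rule power2_le_imp_le) simp
      qed
      have base: "m\<^sup>2 \<le> norm (h\<^sup>2 + of_real (2 * c * e) * h + of_real (e\<^sup>2))" if c: "\<bar>c\<bar> \<le> 1" for c
      proof -
        \<comment> \<open>The quartic in \<open>X\<close> is rewritten as
          \<open>(X^2 + \<rho>)^2 - \<kappa>^2 * X^2\<close>: its constant term fixes
          \<open>\<rho>\<close>, its coefficient of \<open>X^2\<close> fixes
          \<open>\<kappa>\<close>. The bound \<open>\<bar>r + c * e\<bar> \<le> \<rho>\<close> makes
          \<open>\<kappa>\<close> real and puts both quadratic factors into the minimised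
          family.\<close>
        define \<rho> where "\<rho> = sqrt (r\<^sup>2 + 2*c*e*r + e\<^sup>2)"
        have "r\<^sup>2 + 2*c*e*r + e\<^sup>2 = (r + c * e)\<^sup>2 + (1 - c\<^sup>2) * e\<^sup>2" by (simp add: power2_eq_square algebra_simps)
        moreover have "(1 - c\<^sup>2) * e\<^sup>2 \<ge> 0" using c by (simp add: abs_square_le_1)
        ultimately have ge: "(r + c * e)\<^sup>2 \<le> r\<^sup>2 + 2*c*e*r + e\<^sup>2" by linarith
        then have \<rho>2: "\<rho>\<^sup>2 = r\<^sup>2 + 2*c*e*r + e\<^sup>2" unfolding \<rho>_def
          by (intro real_sqrt_pow2) (meson order_trans zero_le_power2)
        have \<rho>: "\<bar>r + c * e\<bar> \<le> \<rho>" using ge unfolding \<rho>_def by (metis real_sqrt_abs real_sqrt_le_iff)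
        define \<kappa> where "\<kappa> = sqrt (2 * \<rho> - 2 * (r + c * e))"
        have \<kappa>2: "\<kappa>\<^sup>2 = 2 * \<rho> - 2 * (r + c * e)" using \<rho> by (simp add: \<kappa>_def)
        have s: "\<rho> - \<kappa>\<^sup>2/4 \<ge> 0" using \<rho> \<kappa>2 by (simp add: abs_le_iff)
        define P K :: 'k where "P = of_real \<rho>" and "K = of_real \<kappa>"
        have PK: "P\<^sup>2 = of_real r^2 + 2 * of_real c * of_real e * of_real r + of_real e^2"
          "K\<^sup>2 = 2 * P - 2 * (of_real r + of_real c * of_real e)"
          unfolding P_def K_def using arg_cong[OF \<rho>2, of "of_real :: real \<Rightarrow> 'k"] arg_cong[OF \<kappa>2, of "of_real :: real \<Rightarrow> 'k"]
          by simp_all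
        have "h\<^sup>2 + of_real (2 * c * e) * h + of_real (e\<^sup>2) = (X\<^sup>2 + P)\<^sup>2 - K\<^sup>2 * X\<^sup>2"
        proof -
          have "(X\<^sup>2 + P)\<^sup>2 - K\<^sup>2 * X\<^sup>2 = X\<^sup>2 * X\<^sup>2 + 2 * P * X\<^sup>2 + P\<^sup>2 - K\<^sup>2 * X\<^sup>2"
            by (simp add: power2_eq_square algebra_simps)
          then show ?thesis unfolding PK h_def by (simp add: power2_eq_square algebra_simps)
        qed
        also have "\<dots> = (X\<^sup>2 - K * X + P) * (X\<^sup>2 + K * X + P)"
          by (simp add: power2_eq_square algebra_simps)
        also have "X\<^sup>2 - K * X + P = (X - of_real (\<kappa>/2))\<^sup>2 + of_real (\<rho> - \<kappa>\<^sup>2/4)"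
          by (simp add: P_def K_def power2_eq_square algebra_simps)
        also have "X\<^sup>2 + K * X + P = (X - of_real (-\<kappa>/2))\<^sup>2 + of_real (\<rho> - \<kappa>\<^sup>2/4)"
          by (simp add: P_def K_def power2_eq_square algebra_simps)
        finally show ?thesis
          using mult_mono[OF quad[OF s] quad[OF s], of "\<kappa>/2" "-\<kappa>/2"] m by (simp add: norm_mult power2_eq_square)
      qed
      \<comment> \<open>Since \<open>norm h = m\<close> and \<open>e < m\<close>, dividing the
        product estimate by \<open>m ^ (?n - 1)\<close> leaves an error that vanishes as
        \<open>k\<close> grows.\<close>
      have "norm (h + of_real e) \<le> m + m * (e/m) ^ (2 * 2^k)" for k
      proof -
        let ?n = "2 * 2^k :: nat"
        have "norm (h + of_real e) * m ^ (?n - 1) \<le> norm (h ^ ?n - of_real (e ^ ?n))"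
          using m minus base by (intro norm_dyadic_diff_ge) auto
        also have "\<dots> \<le> m ^ ?n + e ^ ?n"
          by (rule order_trans[OF norm_triangle_ineq4]) (use e hm in \<open>simp add: norm_power\<close>)
        also have "\<dots> = (m + m * (e/m) ^ ?n) * m ^ (?n - 1)"
        proof -
          have "(m + m * (e/m) ^ ?n) * m ^ (?n - 1) = m ^ (?n - 1) * m * (1 + (e/m) ^ ?n)"
            by (simp add: algebra_simps)
          also have "m ^ (?n - 1) * m = m ^ ?n" by (rule power_minus_mult) simp
          also have "m ^ ?n * (1 + (e/m) ^ ?n) = m ^ ?n + e ^ ?n"
            using m by (simp add: power_divide distrib_left)
          finally show ?thesis by simp
        qed
        finally show ?thesis using m by (simp add: mult_le_cancel_right)
      qed
      moreover have "(\<lambda>k. m + m * (e/m) ^ (2 * 2^k)) \<longlonglongrightarrow> m + m * 0"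
      proof (intro tendsto_intros)
        have "(\<lambda>n. (e/m) ^ n) \<longlonglongrightarrow> 0" using e m by (intro LIMSEQ_realpow_zero) auto
        moreover have "strict_mono (\<lambda>k::nat. 2 * 2^k :: nat)" by (auto simp: strict_mono_def)
        ultimately show "(\<lambda>k. (e/m) ^ (2 * 2^k)) \<longlonglongrightarrow> 0" using LIMSEQ_subseq_LIMSEQ[unfolded comp_def] by blast
      qed
      ultimately have "norm (h + of_real e) \<le> m" by (intro LIMSEQ_le_const) auto
      moreover have "m \<le> norm (h + of_real e)" using quad[of "r + e" 0] r e by (simp add: h_def add.assoc)
      ultimately show ?thesis by (simp add: h_def add.assoc)
    qed
    have all: "norm (X\<^sup>2 + of_real (b0\<^sup>2 + real k * e)) = m" for k
    proof (induction k)
      case 0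
      show ?case by (simp add: m_def f_def X_def)
    next
      case (Suc k)
      show ?case using step[OF _ Suc] e by (simp add: algebra_simps)
    qed
    obtain k where k: "real k * e > m + norm (X\<^sup>2)" using reals_Archimedean3[OF e(1)] by blast
    have "norm (of_real (b0\<^sup>2 + real k * e) :: 'k) \<le> norm (X\<^sup>2 + of_real (b0\<^sup>2 + real k * e)) + norm (X\<^sup>2)"
      using norm_triangle_ineq4[of "X\<^sup>2 + of_real (b0\<^sup>2 + real k * e)" "X\<^sup>2"] by simp
    then have "b0\<^sup>2 + real k * e \<le> m + norm (X\<^sup>2)" using e unfolding all norm_of_real by simp
    then show False using k by (smt (verit) zero_le_power2)
  qed
  then show ?thesis unfolding m_def f_def by auto
qed

text \<open>If some element is not real, its quadratic yields a square root \<open>i\<close> of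
  \<open>-1\<close>. The resulting map from the complex numbers is isometric and onto, and
  \<open>e\<close> is its inverse. The embedding supplies real parts and conjugates for abstract
  scalars.\<close>

lemma real_normed_field_embeds_complex:
  obtains e :: "'k::real_normed_field \<Rightarrow> complex"
  where "\<And>x y. e (x + y) = e x + e y" "\<And>x y. e (x * y) = e x * e y" "\<And>x. norm (e x) = norm x"
    "\<And>r. e (of_real r) = of_real r"
proof (cases "\<forall>z::'k. \<exists>r. z = of_real r")
  case True
  then obtain g where g: "\<And>z::'k. of_real (g z) = z" by metis
  have "g (x + y) = g x + g y" "g (x * y) = g x * g y" "\<bar>g x\<bar> = norm x" "g (of_real t) = t" for x y t
    by (metis g of_real_add of_real_eq_iff, metis g of_real_mult of_real_eq_iff, metis g norm_of_real,
        metis g of_real_eq_iff)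
  then show thesis by (intro that[of "\<lambda>z. of_real (g z)"]) auto
next
  case False
  then obtain z :: 'k where z: "\<And>r. z \<noteq> of_real r" by blast
  obtain a b where ab: "(z - of_real a)\<^sup>2 + of_real (b\<^sup>2) = 0" using real_normed_field_quadratic by blast
  have "b \<noteq> 0" using ab z[of a] by auto
  define i where "i = (z - of_real a) / of_real b"
  have "(z - of_real a)\<^sup>2 = - (of_real (b\<^sup>2))" using ab by (simp add: eq_neg_iff_add_eq_0)
  then have i: "i * i = -1" using \<open>b \<noteq> 0\<close>
    by (simp add: i_def field_simps power2_eq_square)
  define emb :: "complex \<Rightarrow> 'k" where "emb w = of_real (Re w) + of_real (Im w) * i" for w
  have add: "emb (v + w) = emb v + emb w" for v w by (simp add: emb_def algebra_simps)
  have mult: "emb (v * w) = emb v * emb w" for v w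
  proof -
    have "emb v * emb w = of_real (Re v) * of_real (Re w) + of_real (Im v) * of_real (Im w) * (i * i)
        + (of_real (Re v) * of_real (Im w) + of_real (Im v) * of_real (Re w)) * i"
      by (simp add: emb_def algebra_simps)
    then show ?thesis unfolding i by (simp add: emb_def algebra_simps)
  qed
  have one: "emb 1 = 1" by (simp add: emb_def)
  have pow: "emb (w ^ n) = emb w ^ n" for w n by (induction n) (simp_all add: one mult)
  have "norm i * norm i = 1" using arg_cong[OF i, of norm] by (simp add: norm_mult)
  then have ni: "norm i = 1" using norm_ge_zero[of i] by (simp add: square_eq_1_iff)
  have le2: "norm (emb w) \<le> 2 * norm w" for w
  proof -
    have "norm (emb w) \<le> \<bar>Re w\<bar> + \<bar>Im w\<bar>"
      unfolding emb_def by (rule order_trans[OF norm_triangle_ineq]) (simp add: norm_mult ni)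
    then show ?thesis using abs_Re_le_cmod[of w] abs_Im_le_cmod[of w] by linarith
  qed
  text \<open>A multiplicative norm bounded by \<open>2|w|\<close> is bounded by \<open>|w|\<close>: take \<open>n\<close>-th roots on powers.\<close>
  have le: "norm (emb w) \<le> norm w" for w
  proof (cases "w = 0")
    case False
    show ?thesis
    proof (rule ccontr)
      assume "\<not> ?thesis"
      then have "1 < norm (emb w) / norm w" using False by simp
      then obtain n where n: "(norm (emb w) / norm w) ^ n > 2" using real_arch_pow by blast
      moreover have "norm (emb w) ^ n \<le> 2 * norm w ^ n" using le2[of "w ^ n"] by (simp add: pow norm_power)
      ultimately show False using False by (simp add: power_divide field_simps)
    qed
  qed (simp add: emb_def)
  \<comment> \<open>The upper bound for \<open>inverse w\<close> is, by multiplicativity, the lower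
    bound for \<open>w\<close>.\<close>
  have eq: "norm (emb w) = norm w" for w
  proof (cases "w = 0")
    case False
    have "norm (emb w) * norm (emb (inverse w)) = 1" using False by (simp add: one flip: norm_mult mult)
    moreover have "norm (emb w) * norm (emb (inverse w)) \<le> norm (emb w) * inverse (norm w)"
      by (intro mult_left_mono) (use le[of "inverse w"] in \<open>auto simp: norm_inverse\<close>)
    ultimately have "norm w \<le> norm (emb w)" using False by (simp add: field_simps)
    then show ?thesis using le[of w] by simp
  qed (simp add: emb_def)
  \<comment> \<open>The real quadratic satisfied by \<open>x\<close> factors into linear terms with
    the help of \<open>i\<close>.\<close>
  have "\<exists>w. emb w = x" for x
  proof -
    obtain c d where cd: "(x - of_real c)\<^sup>2 + of_real (d\<^sup>2) = 0" using real_normed_field_quadratic by blast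
    have "(x - of_real c - of_real d * i) * (x - of_real c + of_real d * i)
       = (x - of_real c)\<^sup>2 - (of_real d)\<^sup>2 * (i * i)"
      by (simp add: power2_eq_square algebra_simps)
    also have "\<dots> = 0" using cd by (simp add: i)
    finally have "x - of_real c - of_real d * i = 0 \<or> x - of_real c + of_real d * i = 0"
      by (simp only: mult_eq_0_iff)
    moreover have "x = emb (Complex c d)" if "x - of_real c - of_real d * i = 0"
      by (subst eq_iff_diff_eq_0) (use that in \<open>simp add: emb_def algebra_simps\<close>)
    moreover have "x = emb (Complex c (- d))" if "x - of_real c + of_real d * i = 0"
      by (subst eq_iff_diff_eq_0) (use that in \<open>simp add: emb_def algebra_simps\<close>)
    ultimately show ?thesis by blast
  qed
  then obtain e where e: "\<And>x. emb (e x) = x" by metis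
  have diff: "emb (v - w) = emb v - emb w" for v w by (simp add: emb_def algebra_simps)
  have inj: "v = w" if "emb v = emb w" for v w
    using eq[of "v - w"] that by (simp add: diff)
  show thesis
  proof (rule that)
    show "e (x + y) = e x + e y" for x y by (rule inj) (simp add: add e)
    show "e (x * y) = e x * e y" for x y by (rule inj) (simp add: mult e)
    show "norm (e x) = norm x" for x using eq[of "e x"] by (simp add: e)
    show "e (of_real r) = of_real r" for r by (rule inj) (simp add: e, simp add: emb_def)
  qed
qed

section \<open>Compact absolutely convex sets and systems of linear equations\<close>

text \<open>For finitely many functionals, minimise \<open>\<Sum>|y g - c y|\<^sup>2\<close> over \<open>g \<in> B\<close>; the
  first-order condition at the minimiser contradicts the hypothesis unless the minimum is zero.\<close>
lemma compact_absconv_finite_solvable: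
  fixes smv :: "'k::real_normed_field \<Rightarrow> 'v \<Rightarrow> 'v::ab_group_add" and c :: "('v \<Rightarrow> 'k) \<Rightarrow> 'k"
  assumes B: "absconv smv B" "compactin T B" and fin: "finite F"
    and cont: "\<And>y. y \<in> F \<Longrightarrow> continuous_map T euclidean y"
    and lin: "\<And>y a b f g. y \<in> F \<Longrightarrow> f \<in> B \<Longrightarrow> g \<in> B \<Longrightarrow> norm a + norm b \<le> 1 \<Longrightarrow>
        y (smv a f + smv b g) = a * y f + b * y g"
    and bd: "\<And>a s. (\<And>g. g \<in> B \<Longrightarrow> norm (\<Sum>y\<in>F. a y * y g) \<le> s) \<Longrightarrow> norm (\<Sum>y\<in>F. a y * c y) \<le> s"
  shows "\<exists>g\<in>B. \<forall>y\<in>F. y g = c y"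
proof -
  obtain e :: "'k \<Rightarrow> complex" where e_add: "\<And>x y. e (x + y) = e x + e y"
    and e_mult: "\<And>x y. e (x * y) = e x * e y" and e_norm: "\<And>x. norm (e x) = norm x"
    and e_real: "\<And>t. e (of_real t) = of_real t"
    using real_normed_field_embeds_complex by blast
  have e0: "e 0 = 0" using e_real[of 0] by simp
  have e_minus: "e (- x) = - e x" for x using e_add[of x "- x"] e0 by (simp add: eq_neg_iff_add_eq_0 add.commute)
  have e_diff: "e (x - y) = e x - e y" for x y using e_add[of x "- y"] e_minus by simp
  have e_sum: "e (sum f S) = (\<Sum>i\<in>S. e (f i))" for f and S :: "('v \<Rightarrow> 'k) set"
    by (induction S rule: infinite_finite_induct) (simp_all add: e0 e_add)
  define Q where "Q g = (\<Sum>y\<in>F. (norm (y g - c y))\<^sup>2)" for g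
  have "continuous_map T euclidean (\<lambda>g. y g - c y)" if "y \<in> F" for y
    using cont[OF that] continuous_map_compose[of T euclidean y euclidean "\<lambda>x. x - c y"]
    by (simp add: o_def continuous_on_diff)
  then have "continuous_map T euclideanreal Q"
    unfolding Q_def using fin by (intro continuous_map_sum continuous_map_real_pow continuous_map_norm)
  then have cptQ: "compact (Q ` B)"
    using image_compactin[OF B(2)] compactin_euclidean_iff by blast
  have "B \<noteq> {}" using B(1) by (simp add: absconv_def)
  then obtain g0 where g0: "g0 \<in> B" and min: "\<And>g. g \<in> B \<Longrightarrow> Q g0 \<le> Q g"
    using compact_attains_inf[OF cptQ] by auto
  define r where "r y = y g0 - c y" for y
  \<comment> \<open>\<open>a y\<close> is the conjugate of the residual \<open>r y\<close>,
    expressed by norm and division because \<open>'k\<close> carries no conjugation.\<close>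
  define a where "a y = (if r y = 0 then 0 else of_real ((norm (r y))\<^sup>2) / r y)" for y
  have ea: "e (a y) = cnj (e (r y))" for y
  proof (cases "r y = 0")
    case False
    have "a y * r y = of_real ((norm (r y))\<^sup>2)" using False by (simp add: a_def)
    then have "e (a y) * e (r y) = of_real ((norm (r y))\<^sup>2)" by (simp only: e_real flip: e_mult)
    also have "\<dots> = cnj (e (r y)) * e (r y)"
      unfolding e_norm[of "r y", symmetric] complex_norm_square by (rule mult.commute)
    finally show ?thesis using False e_norm[of "r y"] by (metis mult_right_cancel norm_eq_zero)
  qed (simp add: a_def e0)
  \<comment> \<open>\<open>2 * S g\<close> is the derivative of \<open>Q\<close> at
    \<open>g0\<close> in the direction of \<open>g\<close>; minimality along the segment makes it
    non-negative.\<close>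
  define S where "S g = (\<Sum>y\<in>F. Re (e (a y * (y g - y g0))))" for g
  have S: "0 \<le> S g" if g: "g \<in> B" for g
  proof (rule ccontr)
    assume "\<not> 0 \<le> S g"
    then have neg: "S g < 0" by simp
    define D where "D = (\<Sum>y\<in>F. (norm (y g - y g0))\<^sup>2)"
    have D: "D \<ge> 0" by (simp add: D_def sum_nonneg)
    have var: "0 \<le> 2 * t * S g + t\<^sup>2 * D" if t: "0 \<le> t" "t \<le> 1" for t
    proof -
      let ?g = "smv (of_real (1 - t)) g0 + smv (of_real t) g"
      have n: "norm (of_real (1 - t) :: 'k) + norm (of_real t :: 'k) \<le> 1"
        using t by (simp only: norm_of_real)
      have gB: "?g \<in> B" using B(1) g0 g n unfolding absconv_def by blast
      have "(norm (y ?g - c y))\<^sup>2 = (norm (y g0 - c y))\<^sup>2 + 2 * t * Re (e (a y * (y g - y g0)))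
          + t\<^sup>2 * (norm (y g - y g0))\<^sup>2" if y: "y \<in> F" for y
      proof -
        have "y ?g - c y = r y + of_real t * (y g - y g0)"
          using lin[OF y g0 g n] by (simp add: r_def algebra_simps)
        then have eq: "e (y ?g - c y) = e (r y) + of_real t * e (y g - y g0)"
          by (simp only: e_add e_mult e_real)
        have "(norm (u + of_real t * v))\<^sup>2 = (norm u)\<^sup>2 + 2 * t * Re (cnj u * v) + t\<^sup>2 * (norm v)\<^sup>2"
          for u v :: complex unfolding cmod_power2 by (simp add: power2_eq_square algebra_simps)
        from this[of "e (r y)" "e (y g - y g0)"] show ?thesis
          unfolding eq[symmetric] e_norm e_mult ea unfolding r_def .
      qed
      then have "Q ?g = Q g0 + 2 * t * S g + t\<^sup>2 * D"
        unfolding Q_def S_def D_def sum_distrib_left sum.distrib[symmetric] by (intro sum.cong refl)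
      then show ?thesis using min[OF gB] by simp
    qed
    \<comment> \<open>Short enough that \<open>t * D \<le> - S g\<close>, so the linear term wins;
      \<open>D + 1\<close> keeps the denominator positive.\<close>
    define t where "t = min 1 (- S g / (D + 1))"
    have t: "0 < t" "t \<le> 1" using neg D by (auto simp: t_def intro!: divide_neg_pos)
    have "t * D \<le> - S g / (D + 1) * D" using D by (intro mult_right_mono) (auto simp: t_def)
    also have "\<dots> \<le> - S g" using neg D by (simp add: field_simps)
    finally have "2 * S g + t * D < 0" using neg by linarith
    then have "t * (2 * S g + t * D) < 0" using t by (simp add: mult_pos_neg)
    then show False using var[of t] t by (simp add: power2_eq_square algebra_simps)
  qed
  define Y where "Y g = (\<Sum>y\<in>F. a y * y g)" for g
  have Y_ge: "Re (e (Y g0)) \<le> Re (e (Y g))" if "g \<in> B" for g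
  proof -
    have "Re (e (Y g - Y g0)) = S g"
      unfolding Y_def S_def sum_subtractf[symmetric] right_diff_distrib[symmetric] e_sum Re_sum ..
    then show ?thesis using S[OF that] by (simp add: e_diff)
  qed
  have "norm (\<Sum>y\<in>F. a y * c y) \<le> - Re (e (Y g0))"
  proof (rule bd)
    fix g assume g: "g \<in> B"
    \<comment> \<open>The scalar \<open>l\<close> turns \<open>Y g\<close> into
      \<open>- norm (Y g)\<close>. It has norm one, or zero when \<open>Y g = 0\<close>, so the
      multiplied point stays in \<open>B\<close>.\<close>
    define l where "l = - (of_real (norm (Y g)) / Y g)"
    have l: "norm l + norm (0::'k) \<le> 1" by (simp add: l_def norm_divide)
    have "smv l g + smv 0 g \<in> B" using B(1) g l unfolding absconv_def by blast
    then have "Re (e (Y g0)) \<le> Re (e (Y (smv l g + smv 0 g)))" by (rule Y_ge)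
    also have "Y (smv l g + smv 0 g) = l * Y g"
      using lin[OF _ g g l] by (auto simp: Y_def sum_distrib_left intro!: sum.cong)
    also have "\<dots> = of_real (- norm (Y g))" by (simp add: l_def)
    finally show "norm (\<Sum>y\<in>F. a y * y g) \<le> - Re (e (Y g0))" unfolding e_real by (simp add: Y_def)
  qed
  moreover have "- Re (e z) \<le> norm z" for z using abs_Re_le_cmod[of "e z"] by (simp add: e_norm)
  ultimately have "Re (e (Y g0)) \<le> Re (e (\<Sum>y\<in>F. a y * c y))" by (smt (verit))
  \<comment> \<open>The left side was just bounded above by zero; identifying it with the sum of
    squared residuals forces all residuals to vanish.\<close>
  moreover have "Re (e (Y g0)) - Re (e (\<Sum>y\<in>F. a y * c y)) = (\<Sum>y\<in>F. (norm (r y))\<^sup>2)"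
  proof -
    have "Re (e (Y g0)) - Re (e (\<Sum>y\<in>F. a y * c y)) = Re (e (\<Sum>y\<in>F. a y * r y))"
      by (simp add: Y_def r_def right_diff_distrib sum_subtractf e_diff)
    also have "\<dots> = (\<Sum>y\<in>F. Re (cnj (e (r y)) * e (r y)))" by (simp only: e_sum Re_sum e_mult ea)
    also have "\<dots> = (\<Sum>y\<in>F. (norm (r y))\<^sup>2)"
    proof (rule sum.cong)
      show "Re (cnj (e (r y)) * e (r y)) = (norm (r y))\<^sup>2" for y
        using cmod_power2[of "e (r y)"] by (simp add: e_norm power2_eq_square)
    qed simp
    finally show ?thesis .
  qed
  ultimately have "(\<Sum>y\<in>F. (norm (r y))\<^sup>2) \<le> 0" by linarith
  then have "(\<Sum>y\<in>F. (norm (r y))\<^sup>2) = 0" by (intro antisym sum_nonneg) auto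
  then have "\<forall>y\<in>F. r y = 0" using fin by (subst (asm) sum_nonneg_eq_0_iff) auto
  then show ?thesis using g0 by (auto simp: r_def)
qed

text \<open>Each equation cuts out a closed set, and finitely many of these meet in \<open>B\<close>
  by the finite case; compactness then gives a common point through the finite intersection
  property.\<close>

lemma compact_absconv_solvable:
  fixes smv :: "'k::real_normed_field \<Rightarrow> 'v \<Rightarrow> 'v::ab_group_add" and c :: "('v \<Rightarrow> 'k) \<Rightarrow> 'k"
  assumes B: "absconv smv B" "compactin T B"
    and cont: "\<And>y. y \<in> Y \<Longrightarrow> continuous_map T euclidean y"
    and lin: "\<And>y a b f g. y \<in> Y \<Longrightarrow> f \<in> B \<Longrightarrow> g \<in> B \<Longrightarrow> norm a + norm b \<le> 1 \<Longrightarrow>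
        y (smv a f + smv b g) = a * y f + b * y g"
    and bd: "\<And>F a s. finite F \<Longrightarrow> F \<subseteq> Y \<Longrightarrow> (\<And>g. g \<in> B \<Longrightarrow> norm (\<Sum>y\<in>F. a y * y g) \<le> s) \<Longrightarrow>
        norm (\<Sum>y\<in>F. a y * c y) \<le> s"
  shows "\<exists>g\<in>B. \<forall>y\<in>Y. y g = c y"
proof -
  define C where "C y = {g \<in> topspace T. y g \<in> {c y}}" for y
  have sub: "B \<subseteq> topspace T" using B(2) by (rule compactin_subset_topspace)
  have cl: "closedin T (C y)" if "y \<in> Y" for y
    unfolding C_def using cont[OF that] by (rule closedin_continuous_map_preimage) auto
  have ne: "B \<inter> \<Inter>(C ` F) \<noteq> {}" if F: "finite F" "F \<subseteq> Y" for F
  proof -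
    have "\<exists>g\<in>B. \<forall>y\<in>F. y g = c y"
    proof (rule compact_absconv_finite_solvable[OF B F(1)])
      show "continuous_map T euclidean y" if "y \<in> F" for y using cont that F(2) by blast
      show "y (smv a f + smv b g) = a * y f + b * y g"
        if "y \<in> F" "f \<in> B" "g \<in> B" "norm a + norm b \<le> 1" for y a b f g
        using lin[of y f g a b] that F(2) by blast
      show "norm (\<Sum>y\<in>F. a y * c y) \<le> s" if "\<And>g. g \<in> B \<Longrightarrow> norm (\<Sum>y\<in>F. a y * y g) \<le> s" for a s
        by (rule bd[OF F that])
    qed
    then show ?thesis using sub by (auto simp: C_def)
  qed
  have "B \<inter> \<Inter>(C ` Y) \<noteq> {}"
  proof -
    have "(\<forall>D\<in>C ` Y. closedin T D) \<and> (\<forall>\<F>. finite \<F> \<and> \<F> \<subseteq> C ` Y \<longrightarrow> B \<inter> \<Inter>\<F> \<noteq> {})"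
      using cl ne by (metis finite_subset_image imageE)
    then show ?thesis using B(2) unfolding compactin_fip by blast
  qed
  then show ?thesis by (auto simp: C_def)
qed

section \<open>Topologies given by seminorms and their duals\<close>

lemma istopology_sn:
  fixes s :: "'i \<Rightarrow> 'v::ab_group_add \<Rightarrow> real"
  shows
  "istopology (\<lambda>V. V \<subseteq> X \<and> (\<forall>f\<in>V. \<exists>F \<epsilon>. finite F \<and> F \<subseteq> I \<and> 0 < \<epsilon>
        \<and> {g\<in>X. \<forall>i\<in>F. s i (g - f) < \<epsilon>} \<subseteq> V))"
  (is "istopology ?P")
  unfolding istopology_def
proof (intro conjI allI impI)
  fix S T assume S: "?P S" and T: "?P T"
  show "S \<inter> T \<subseteq> X" using S by blast
  show "\<forall>f\<in>S \<inter> T. \<exists>F \<epsilon>. finite F \<and> F \<subseteq> I \<and> 0 < \<epsilon> \<and> {g\<in>X. \<forall>i\<in>F. s i (g - f) < \<epsilon>} \<subseteq> S \<inter> T"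
  proof
    fix f assume f: "f \<in> S \<inter> T"
    obtain F \<epsilon> where 1: "finite F" "F \<subseteq> I" "0 < \<epsilon>" "{g\<in>X. \<forall>i\<in>F. s i (g - f) < \<epsilon>} \<subseteq> S" using S f by blast
    obtain F' \<epsilon>' where 2: "finite F'" "F' \<subseteq> I" "0 < \<epsilon>'" "{g\<in>X. \<forall>i\<in>F'. s i (g - f) < \<epsilon>'} \<subseteq> T" using T f by blast
    show "\<exists>F \<epsilon>. finite F \<and> F \<subseteq> I \<and> 0 < \<epsilon> \<and> {g\<in>X. \<forall>i\<in>F. s i (g - f) < \<epsilon>} \<subseteq> S \<inter> T"
      by (rule exI[of _ "F \<union> F'"], rule exI[of _ "min \<epsilon> \<epsilon>'"]) (use 1 2 in auto)
  qed
next
  fix \<K> assume K: "\<forall>S\<in>\<K>. ?P S"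
  show "\<Union>\<K> \<subseteq> X" using K by blast
  show "\<forall>f\<in>\<Union>\<K>. \<exists>F \<epsilon>. finite F \<and> F \<subseteq> I \<and> 0 < \<epsilon> \<and> {g\<in>X. \<forall>i\<in>F. s i (g - f) < \<epsilon>} \<subseteq> \<Union>\<K>"
  proof
    fix f assume "f \<in> \<Union>\<K>"
    then obtain S where S: "S \<in> \<K>" "f \<in> S" by (rule UnionE)
    have "?P S" using K S(1) by (rule bspec)
    then obtain F \<epsilon> where "finite F" "F \<subseteq> I" "0 < \<epsilon>" "{g\<in>X. \<forall>i\<in>F. s i (g - f) < \<epsilon>} \<subseteq> S"
      using S(2) by meson
    then show "\<exists>F \<epsilon>. finite F \<and> F \<subseteq> I \<and> 0 < \<epsilon> \<and> {g\<in>X. \<forall>i\<in>F. s i (g - f) < \<epsilon>} \<subseteq> \<Union>\<K>"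
      using S by (intro exI[of _ F] exI[of _ \<epsilon>]) blast
  qed
qed

lemma openin_sn:
  "openin (sn_topology X I s) V \<longleftrightarrow> V \<subseteq> X \<and> (\<forall>f\<in>V. \<exists>F \<epsilon>. finite F \<and> F \<subseteq> I \<and> 0 < \<epsilon>
        \<and> {g\<in>X. \<forall>i\<in>F. s i (g - f) < \<epsilon>} \<subseteq> V)"
  unfolding sn_topology_def using topology_inverse'[OF istopology_sn, of X I s] by simp

lemma topspace_sn: "topspace (sn_topology X I s) = X"
proof
  show "topspace (sn_topology X I s) \<subseteq> X"
    using openin_topspace[of "sn_topology X I s"] unfolding openin_sn by blast
  have "openin (sn_topology X I s) X"
    unfolding openin_sn by (auto intro!: exI[of _ "{}"] exI[of _ "1::real"])
  then show "X \<subseteq> topspace (sn_topology X I s)" by (rule openin_subset)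
qed

section \<open>Functionals continuous for a family of seminorms\<close>

lemma dual_add: "y \<in> dual sm X I s \<Longrightarrow> f \<in> X \<Longrightarrow> g \<in> X \<Longrightarrow> y (f + g) = y f + y g"
  and dual_scale: "y \<in> dual sm X I s \<Longrightarrow> f \<in> X \<Longrightarrow> y (sm c f) = c * y f"
  and dual_outside: "y \<in> dual sm X I s \<Longrightarrow> f \<notin> X \<Longrightarrow> y f = 0"
  unfolding dual_def by blast+

lemma dual_zero: "y \<in> dual sm X I s \<Longrightarrow> y 0 = 0"
  using dual_add[of y sm X I s 0 0] dual_outside[of y sm X I s 0] by (cases "0 \<in> X") auto

lemma dual_bound: "y \<in> dual sm X I s \<Longrightarrow> \<exists>i\<in>I. \<exists>C. \<forall>f\<in>X. norm (y f) \<le> C * s i f"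
  unfolding dual_def by blast

lemma dual_cmult:
  assumes "y \<in> dual sm X I s"
  shows "(\<lambda>f. c * y f) \<in> dual sm X I s"
proof -
  obtain i C where i: "i \<in> I" and C: "\<And>f. f \<in> X \<Longrightarrow> norm (y f) \<le> C * s i f"
    using dual_bound[OF assms] by blast
  have "norm (c * y f) \<le> norm c * C * s i f" if "f \<in> X" for f
    using mult_left_mono[OF C[OF that], of "norm c"] by (simp add: norm_mult mult.assoc)
  then have "\<exists>i\<in>I. \<exists>C. \<forall>f\<in>X. norm (c * y f) \<le> C * s i f" using i by blast
  then show ?thesis using dual_add[OF assms] dual_scale[OF assms] dual_outside[OF assms]
    by (simp add: dual_def algebra_simps)
qed

text \<open>Membership in \<open>dual\<close> demands a bound by one seminorm; directedness merges
  the bounds of the two summands.\<close>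

lemma dual_sum:
  assumes y: "y \<in> dual sm X I s" and z: "z \<in> dual sm X I s"
    and dir: "directed_sn X I s" and nonneg: "\<And>i f. i \<in> I \<Longrightarrow> f \<in> X \<Longrightarrow> 0 \<le> s i f"
  shows "(\<lambda>f. y f + z f) \<in> dual sm X I s"
proof -
  obtain i C where i: "i \<in> I" and C: "\<And>f. f \<in> X \<Longrightarrow> norm (y f) \<le> C * s i f" using dual_bound[OF y] by blast
  obtain j D where j: "j \<in> I" and D: "\<And>f. f \<in> X \<Longrightarrow> norm (z f) \<le> D * s j f" using dual_bound[OF z] by blast
  obtain k K where k: "k \<in> I" and K: "\<And>f. f \<in> X \<Longrightarrow> max (s i f) (s j f) \<le> K * s k f"
    using dir i j unfolding directed_sn_def by blast
  have "norm (y f + z f) \<le> (\<bar>C\<bar> + \<bar>D\<bar>) * K * s k f" if f: "f \<in> X" for f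
  proof -
    have "norm (y f + z f) \<le> C * s i f + D * s j f"
      using norm_triangle_ineq[of "y f" "z f"] C[OF f] D[OF f] by linarith
    also have "\<dots> \<le> \<bar>C\<bar> * (K * s k f) + \<bar>D\<bar> * (K * s k f)"
      using K[OF f] nonneg[OF i f] nonneg[OF j f] by (intro add_mono mult_mono) auto
    finally show ?thesis by (simp add: algebra_simps)
  qed
  then have "\<exists>i\<in>I. \<exists>C. \<forall>f\<in>X. norm (y f + z f) \<le> C * s i f" using k by blast
  then show ?thesis
    using dual_add[OF y] dual_scale[OF y] dual_outside[OF y] dual_add[OF z] dual_scale[OF z] dual_outside[OF z]
    by (simp add: dual_def algebra_simps)
qed

lemma dual_continuous_map:
  fixes sm :: "'k::real_normed_field \<Rightarrow> 'v::ab_group_add \<Rightarrow> 'v"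
  assumes y: "y \<in> dual sm X I s" and X: "\<And>f g. f \<in> X \<Longrightarrow> g \<in> X \<Longrightarrow> f - g \<in> X"
    and nonneg: "\<And>i f. i \<in> I \<Longrightarrow> f \<in> X \<Longrightarrow> 0 \<le> s i f"
  shows "continuous_map (sn_topology X I s) euclidean y"
  unfolding continuous_map openin_sn topspace_sn
proof (intro conjI allI impI ballI)
  obtain i C where i: "i \<in> I" and C: "\<And>f. f \<in> X \<Longrightarrow> norm (y f) \<le> C * s i f"
    using dual_bound[OF y] by blast
  fix S :: "'k set" and f assume "openin euclidean S" and "f \<in> {x \<in> X. y x \<in> S}"
  then obtain \<delta> where f: "f \<in> X" and \<delta>: "\<delta> > 0" "ball (y f) \<delta> \<subseteq> S"
    by (auto simp: open_contains_ball)
  \<comment> \<open>\<open>C\<close> may be zero or negative, while the radius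
    \<open>\<delta> / K\<close> needs a positive denominator.\<close>
  define K where "K = max C 1"
  have "y g \<in> S" if g: "g \<in> X" and lt: "s i (g - f) < \<delta> / K" for g
  proof -
    have "y g = y (g - f) + y f" using dual_add[OF y X[OF g f] f] by simp
    then have "dist (y f) (y g) = norm (y (g - f))" by (simp add: dist_norm norm_minus_commute)
    also have "\<dots> \<le> C * s i (g - f)" using C X[OF g f] by blast
    also have "\<dots> \<le> K * s i (g - f)" using nonneg[OF i X[OF g f]] by (intro mult_right_mono) (auto simp: K_def)
    also have "\<dots> < \<delta>" using lt by (simp add: K_def field_simps)
    finally show ?thesis using \<delta>(2) by auto
  qed
  then show "\<exists>F \<epsilon>. finite F \<and> F \<subseteq> I \<and> 0 < \<epsilon> \<and> {g \<in> X. \<forall>i\<in>F. s i (g - f) < \<epsilon>} \<subseteq> {x \<in> X. y x \<in> S}"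
    using i \<delta>(1) by (intro exI[of _ "{i}"] exI[of _ "\<delta> / K"]) (auto simp: K_def)
qed auto
text \<open>Kept general in the weights because it serves both weighted scalar spaces of the
  theorem. Suprema are traded for pointwise bounds by \<open>le_iff\<close>, where non-emptiness and
  boundedness of the sets enter.\<close>

lemma FVK_subspace_seminorm:
  fixes TK :: "'m \<Rightarrow> ('x \<Rightarrow> 'k::real_normed_field) \<Rightarrow> ('x \<Rightarrow> 'k)"
  assumes wd: "weight_data \<Omega> J L Ml \<nu> M M0 \<omega>" and op: "op_data (*) \<Omega> M \<omega> domK TK"
  defines "X \<equiv> FVK \<Omega> J L Ml \<nu> M M0 \<omega> domK TK"
  shows "subspace_sm (fscale (*)) X"
    and "\<And>i. i \<in> J \<times> L \<times> UNIV \<Longrightarrow> seminorm_on (fscale (*)) X (snK \<Omega> Ml \<nu> TK i)"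
proof -
  have W: "\<Omega> \<noteq> {}" "\<forall>l\<in>L. Ml l \<noteq> {}" "\<forall>j l m. \<forall>x\<in>\<Omega>. 0 \<le> \<nu> j l m x" "(\<Union>l\<in>L. Ml l) \<subseteq> M"
      "\<forall>m\<in>(\<Union>l\<in>L. Ml l). \<Omega> \<subseteq> \<omega> m" and M0: "M0 \<subseteq> M"
    using wd unfolding weight_data_def by simp_all
  have bdd: "bdd_above {h x m | x m. x \<in> \<Omega> \<and> m \<in> Ml l} \<longleftrightarrow> (\<exists>c. \<forall>x\<in>\<Omega>. \<forall>m\<in>Ml l. h x m \<le> c)"
    for h :: "'x \<Rightarrow> 'm \<Rightarrow> real" and l
    unfolding bdd_above_def by (intro arg_cong[where f = Ex] ext) auto
  have mem: "f \<in> X \<longleftrightarrow> f \<in> ext0 \<Omega> \<and> (\<forall>m\<in>M. f \<in> domK m) \<and> (\<forall>m\<in>M0. \<forall>x\<in>\<omega> m. TK m f x = 0)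
      \<and> (\<forall>j\<in>J. \<forall>l\<in>L. \<exists>c. \<forall>x\<in>\<Omega>. \<forall>m\<in>Ml l. norm (TK m f x) * \<nu> j l m x \<le> c)" for f
    unfolding X_def FVspace_def bdd by simp
  have ne: "{norm (TK m f x) * \<nu> j l m x | x m. x \<in> \<Omega> \<and> m \<in> Ml l} \<noteq> {}" if "l \<in> L" for f j l
    using W(1,2) that by fast
  have le_iff: "snK \<Omega> Ml \<nu> TK (j,l,a) f \<le> c \<longleftrightarrow> (\<forall>x\<in>\<Omega>. \<forall>m\<in>Ml l. norm (TK m f x) * \<nu> j l m x \<le> c)"
    if "f \<in> X" "j \<in> J" "l \<in> L" for f j l c a
  proof -
    have "bdd_above {norm (TK m f x) * \<nu> j l m x | x m. x \<in> \<Omega> \<and> m \<in> Ml l}"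
      unfolding bdd using that(1)[unfolded mem] that(2,3) by blast
    from cSup_le_iff[OF ne[OF that(3)] this] show ?thesis unfolding wsn_def by auto
  qed
  have le: "norm (TK m f x) * \<nu> j l m x \<le> snK \<Omega> Ml \<nu> TK (j,l,a) f"
    if "f \<in> X" "j \<in> J" "l \<in> L" "x \<in> \<Omega>" "m \<in> Ml l" for f j l x m a
    using le_iff[OF that(1-3), of a "snK \<Omega> Ml \<nu> TK (j,l,a) f"] that(4,5) by blast
  have \<nu>: "0 \<le> \<nu> j l m x" if "x \<in> \<Omega>" for j l m x using W(3) that by blast
  have M: "m \<in> M" "x \<in> \<omega> m" if "m \<in> Ml l" "l \<in> L" "x \<in> \<Omega>" for m l x
    using W(4,5) that by blast+
  have dom: "0 \<in> domK m" "f \<in> domK m \<Longrightarrow> g \<in> domK m \<Longrightarrow> f + g \<in> domK m"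
    "f \<in> domK m \<Longrightarrow> fscale (*) c f \<in> domK m" if "m \<in> M" for m f g c
    using op that unfolding op_data_def subspace_sm_def by blast+
  have T_add: "TK m (f + g) x = TK m f x + TK m g x"
    if "m \<in> M" "f \<in> domK m" "g \<in> domK m" "x \<in> \<omega> m" for m f g x
    using op that unfolding op_data_def by blast
  have T_scale: "TK m (fscale (*) c f) x = c * TK m f x"
    if "m \<in> M" "f \<in> domK m" "x \<in> \<omega> m" for m f c x
    using op that unfolding op_data_def by blast
  have fs0: "fscale (*) 0 f = 0" for f :: "'x \<Rightarrow> 'k" by (auto simp: fscale_def)
  have T0: "TK m 0 x = 0" if "m \<in> M" "x \<in> \<omega> m" for m x
    using T_scale[OF that(1) dom(1)[OF that(1)] that(2), of 0] by (simp add: fs0)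
  have Xdom: "f \<in> domK m" if "f \<in> X" "m \<in> M" for f m using that mem by blast
  have bd_add: "norm (TK m (f + g) x) * \<nu> j l m x
      \<le> snK \<Omega> Ml \<nu> TK (j,l,a) f + snK \<Omega> Ml \<nu> TK (j,l,a) g"
    if f: "f \<in> X" and g: "g \<in> X" and i: "j \<in> J" "l \<in> L" "x \<in> \<Omega>" "m \<in> Ml l" for f g j l a x m
  proof -
    have "norm (TK m (f + g) x) * \<nu> j l m x \<le> (norm (TK m f x) + norm (TK m g x)) * \<nu> j l m x"
      using T_add[OF M(1) Xdom[OF f M(1)] Xdom[OF g M(1)] M(2), OF i(4,2,3) i(4,2,3) i(4,2,3) i(4,2,3)]
        \<nu>[OF i(3)]
      by (simp add: mult_right_mono norm_triangle_ineq)
    then show ?thesis using le[OF f i, of a] le[OF g i, of a] by (simp add: distrib_right)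
  qed
  have bd_scale: "norm (TK m (fscale (*) c f) x) * \<nu> j l m x \<le> norm c * snK \<Omega> Ml \<nu> TK (j,l,a) f"
    if f: "f \<in> X" and i: "j \<in> J" "l \<in> L" "x \<in> \<Omega>" "m \<in> Ml l" for f c j l a x m
    using mult_left_mono[OF le[OF f i, of a], of "norm c"] T_scale[OF M(1) Xdom[OF f M(1)] M(2), OF i(4,2,3) i(4,2,3) i(4,2,3)]
    by (simp add: norm_mult mult.assoc)
  have add: "f + g \<in> X" if f: "f \<in> X" and g: "g \<in> X" for f g
    unfolding mem
  proof (intro conjI ballI)
    show "f + g \<in> ext0 \<Omega>" using f g by (simp add: mem ext0_def)
    show "f + g \<in> domK m" if "m \<in> M" for m using dom(2)[OF that Xdom[OF f that] Xdom[OF g that]] .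
    show "TK m (f + g) x = 0" if "m \<in> M0" "x \<in> \<omega> m" for m x
      using T_add[of m f g x] that M0 f g Xdom by (auto simp: mem)
    show "\<exists>c. \<forall>x\<in>\<Omega>. \<forall>m\<in>Ml l. norm (TK m (f + g) x) * \<nu> j l m x \<le> c" if "j \<in> J" "l \<in> L" for j l
      using bd_add[OF f g that] by blast
  qed
  have scale: "fscale (*) c f \<in> X" if f: "f \<in> X" for c f
    unfolding mem
  proof (intro conjI ballI)
    show "fscale (*) c f \<in> ext0 \<Omega>" using f by (simp add: mem ext0_def fscale_def)
    show "fscale (*) c f \<in> domK m" if "m \<in> M" for m using dom(3)[OF that Xdom[OF f that]] .
    show "TK m (fscale (*) c f) x = 0" if "m \<in> M0" "x \<in> \<omega> m" for m x
      using T_scale[of m f x c] that M0 f Xdom by (auto simp: mem)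
    show "\<exists>c'. \<forall>x\<in>\<Omega>. \<forall>m\<in>Ml l. norm (TK m (fscale (*) c f) x) * \<nu> j l m x \<le> c'" if "j \<in> J" "l \<in> L" for j l
      using bd_scale[OF f that] by blast
  qed
  have zero: "0 \<in> X"
    unfolding mem using dom(1) T0 M0 M by (auto simp: ext0_def intro!: exI[of _ 0])
  show "subspace_sm (fscale (*)) X" unfolding subspace_sm_def using zero add scale by blast
  fix i assume "i \<in> J \<times> L \<times> (UNIV :: unit set)"
  then obtain j l a where i: "i = (j,l,a)" and jl: "j \<in> J" "l \<in> L" by (cases i) auto
  let ?s = "snK \<Omega> Ml \<nu> TK i"
  have nonneg: "0 \<le> ?s f" if f: "f \<in> X" for f
  proof -
    obtain x m where "x \<in> \<Omega>" "m \<in> Ml l" using ne[OF jl(2)] by blast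
    then show ?thesis using le[OF f jl, of x m a] \<nu>[of x j l m] i by (smt (verit) mult_nonneg_nonneg norm_ge_zero)
  qed
  have sc: "?s (fscale (*) c f) \<le> norm c * ?s f" if f: "f \<in> X" for c f
    unfolding i le_iff[OF scale[OF f] jl] using bd_scale[OF f jl] by blast
  \<comment> \<open>The reverse inequality is \<open>sc\<close> for the factor
    \<open>inverse c\<close>, applied to the scaled function.\<close>
  have "norm c * ?s f \<le> ?s (fscale (*) c f)" if f: "f \<in> X" for c f
  proof (cases "c = 0")
    case True
    then show ?thesis using nonneg[OF scale[OF f]] by simp
  next
    case False
    have "fscale (*) (inverse c) (fscale (*) c f) = f" using False by (auto simp: fscale_def)
    then have "?s f \<le> inverse (norm c) * ?s (fscale (*) c f)"
      using sc[OF scale[OF f], of "inverse c" c] by (simp add: norm_inverse)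
    then show ?thesis using False by (simp add: field_simps)
  qed
  moreover have "?s (f + g) \<le> ?s f + ?s g" if f: "f \<in> X" and g: "g \<in> X" for f g
    unfolding i le_iff[OF add[OF f g] jl] using bd_add[OF f g jl] by blast
  ultimately show "seminorm_on (fscale (*)) X ?s"
    unfolding seminorm_on_def using nonneg sc by (auto intro: antisym)
qed

section \<open>A compact unit ball in a coarser topology\<close>

text \<open>\<open>X\<close> with the seminorms \<open>s\<close> stands for FW, and \<open>V\<close>
  with the norm \<open>q\<close> for FV, so that the functional analysis is free of weights and
  operators.\<close>

locale compact_unit_ball =
  fixes X :: "('x \<Rightarrow> 'k::real_normed_field) set" and I :: "'i set" and s and V q
  assumes X_sub: "subspace_sm (fscale (*)) X"
    and s: "\<And>i. i \<in> I \<Longrightarrow> seminorm_on (fscale (*)) X (s i)"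
    and I_ne: "I \<noteq> {}" and dir: "directed_sn X I s"
    and V_sub: "subspace_sm (fscale (*)) V"
    and q: "seminorm_on (fscale (*)) V q"
    and q_eq_0: "\<And>f. f \<in> V \<Longrightarrow> q f = 0 \<Longrightarrow> f = 0"
    and ball_sub: "unit_ball V q \<subseteq> X"
    and ball_compact: "compactin (sn_topology X I s) (unit_ball V q)"
begin

abbreviation "B \<equiv> unit_ball V q"
abbreviation "Y \<equiv> dual (fscale (*)) X I s"

lemma X_scale: "f \<in> X \<Longrightarrow> fscale (*) c f \<in> X" and X_add: "f \<in> X \<Longrightarrow> g \<in> X \<Longrightarrow> f + g \<in> X"
  and X_zero: "0 \<in> X"
  and V_scale: "f \<in> V \<Longrightarrow> fscale (*) c f \<in> V" and V_add: "f \<in> V \<Longrightarrow> g \<in> V \<Longrightarrow> f + g \<in> V"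
  and V_zero: "0 \<in> V"
  using X_sub V_sub unfolding subspace_sm_def by blast+

lemma X_diff: "f \<in> X \<Longrightarrow> g \<in> X \<Longrightarrow> f - g \<in> X"
proof -
  assume "f \<in> X" "g \<in> X"
  then have "f + fscale (*) (-1) g \<in> X" by (intro X_add X_scale)
  moreover have "f + fscale (*) (-1) g = f - g" by (auto simp: fscale_def)
  ultimately show ?thesis by simp
qed

lemma q_nonneg: "f \<in> V \<Longrightarrow> 0 \<le> q f" and q_add: "f \<in> V \<Longrightarrow> g \<in> V \<Longrightarrow> q (f + g) \<le> q f + q g"
  and q_scale: "f \<in> V \<Longrightarrow> q (fscale (*) c f) = norm c * q f"
  using q unfolding seminorm_on_def by blast+

lemma s_nonneg: "i \<in> I \<Longrightarrow> f \<in> X \<Longrightarrow> 0 \<le> s i f"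
  using s unfolding seminorm_on_def by blast

lemma zero_in_ball: "0 \<in> B"
proof -
  have "fscale (*) 0 (0 :: 'x \<Rightarrow> 'k) = 0" by (auto simp: fscale_def)
  then show ?thesis using q_scale[OF V_zero, of 0] V_zero by (simp add: unit_ball_def)
qed

lemma absconv_ball: "absconv (fscale (*)) B"
  unfolding absconv_def
proof (intro conjI ballI allI impI)
  show "B \<noteq> {}" using zero_in_ball by blast
  fix f g and a b :: 'k assume fg: "f \<in> B" "g \<in> B" and ab: "norm (a::'k) + norm (b::'k) \<le> 1"
  then have V: "f \<in> V" "g \<in> V" "q f \<le> 1" "q g \<le> 1" by (auto simp: unit_ball_def)
  have "q (fscale (*) a f + fscale (*) b g) \<le> norm a * q f + norm b * q g"
    using q_add[OF V_scale[OF V(1)] V_scale[OF V(2)], of a b] by (simp add: q_scale V)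
  also have "\<dots> \<le> norm a * 1 + norm b * 1" using V by (intro add_mono mult_left_mono) auto
  finally show "fscale (*) a f + fscale (*) b g \<in> B"
    using ab V by (auto simp: unit_ball_def intro!: V_add V_scale)
qed

lemma in_scaled_ball:
  assumes "f \<in> V" "f \<noteq> 0"
  obtains g where "g \<in> B" "f = fscale (*) (of_real (q f)) g" "q f > 0"
proof -
  have pos: "q f > 0" using q_eq_0 q_nonneg assms by (metis less_eq_real_def)
  show thesis
  proof (rule that[of "fscale (*) (of_real (inverse (q f))) f"])
    show "fscale (*) (of_real (inverse (q f))) f \<in> B"
      using assms pos q_scale[of f "of_real (inverse (q f))"] by (simp add: unit_ball_def V_scale norm_inverse)
    show "f = fscale (*) (of_real (q f)) (fscale (*) (of_real (inverse (q f))) f)"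
      using pos by (auto simp: fscale_def)
  qed (rule pos)
qed

lemma V_subset: "V \<subseteq> X"
proof
  fix f assume f: "f \<in> V"
  show "f \<in> X"
  proof (cases "f = 0")
    case False
    then show ?thesis by (metis in_scaled_ball f X_scale ball_sub subsetD)
  qed (simp add: X_zero)
qed

text \<open>Rescaling to the unit ball: this is the operator norm estimate with respect to
  \<open>q\<close>.\<close>

lemma dual_le_norm:
  assumes y: "y \<in> Y" and f: "f \<in> V" and le: "\<And>g. g \<in> B \<Longrightarrow> norm (y g) \<le> t"
  shows "norm (y f) \<le> t * q f"
proof (cases "f = 0")
  case True
  then show ?thesis
    using dual_zero[OF y] le[OF zero_in_ball] q_nonneg[OF f] by (simp add: mult_nonneg_nonneg)
next
  case False
  then obtain g where g: "g \<in> B" "f = fscale (*) (of_real (q f)) g" "q f > 0" using in_scaled_ball f by blast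
  have "norm (y f) = q f * norm (y g)"
    using arg_cong[OF g(2), of "\<lambda>f. norm (y f)"] dual_scale[OF y, of g "of_real (q f)"] g ball_sub
    by (auto simp: norm_mult)
  then show ?thesis using le[OF g(1)] g(3) by (simp add: mult.commute)
qed

lemma dual_continuous: "y \<in> Y \<Longrightarrow> continuous_map (sn_topology X I s) euclidean y"
  by (rule dual_continuous_map) (auto intro: X_diff s_nonneg)

lemma dual_bdd_ball:
  assumes "y \<in> Y" shows "bdd_above ((\<lambda>g. norm (y g)) ` B)"
proof -
  have "compact (y ` B)"
    using image_compactin[OF ball_compact dual_continuous[OF assms]] compactin_euclidean_iff by blast
  then have "bounded (y ` B)" by (rule compact_imp_bounded)
  then show ?thesis by (auto simp: bounded_iff bdd_above_def)
qed

lemma dual_solvable: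
  assumes Z: "Z \<subseteq> Y"
    and bd: "\<And>F a t. finite F \<Longrightarrow> F \<subseteq> Z \<Longrightarrow> (\<And>g. g \<in> B \<Longrightarrow> norm (\<Sum>y\<in>F. a y * y g) \<le> t) \<Longrightarrow>
        norm (\<Sum>y\<in>F. a y * c y) \<le> t"
  shows "\<exists>g\<in>B. \<forall>y\<in>Z. y g = c y"
proof (rule compact_absconv_solvable[OF absconv_ball ball_compact])
  show "continuous_map (sn_topology X I s) euclidean y" if "y \<in> Z" for y
    using dual_continuous that Z by blast
  show "y (fscale (*) a f + fscale (*) b g) = a * y f + b * y g"
    if y: "y \<in> Z" and fg: "f \<in> B" "g \<in> B" for y a b f g
  proof -
    have y: "y \<in> Y" and "f \<in> X" "g \<in> X" using y fg Z ball_sub by auto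
    then show ?thesis using dual_add[OF y X_scale X_scale] dual_scale[OF y] by simp
  qed
qed (rule bd)

text \<open>\<open>P\<close> is left arbitrary because the lemma serves both \<open>Y\<close> and
  the set of representable functionals.\<close>

lemma dual_sum_closed:
  assumes zero: "(\<lambda>_. 0) \<in> P" and add: "\<And>y z. y \<in> P \<Longrightarrow> z \<in> P \<Longrightarrow> (\<lambda>f. y f + z f) \<in> P"
    and mult: "\<And>c y. y \<in> P \<Longrightarrow> (\<lambda>f. c * y f) \<in> P"
    and F: "finite F" "F \<subseteq> P"
  shows "(\<lambda>g. \<Sum>y\<in>F. a y * y g) \<in> P"
  using F by (induction F) (auto intro: zero add mult)

lemma Y_zero: "(\<lambda>_. 0) \<in> Y"
proof -
  have "\<exists>i\<in>I. \<exists>C. \<forall>f\<in>X. 0 \<le> C * s i f" using I_ne s_nonneg by (metis all_not_in_conv mult_1)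
  then show ?thesis by (simp add: dual_def)
qed

lemma Y_add: "y \<in> Y \<Longrightarrow> z \<in> Y \<Longrightarrow> (\<lambda>f. y f + z f) \<in> Y"
  by (rule dual_sum) (auto intro: dir s_nonneg)

text \<open>By homogeneity the bound on the polar becomes \<open>norm (\<phi> y) \<le> K * t\<close>
  whenever \<open>norm (y g) \<le> t\<close> on \<open>B\<close>. This is the solvability condition
  for the right-hand side \<open>\<phi> y / K\<close>; multiplying the solution in \<open>B\<close>
  by \<open>K\<close> gives the element of \<open>V\<close>.\<close>

lemma functional_eval:
  fixes \<phi> :: "(('x \<Rightarrow> 'k) \<Rightarrow> 'k) \<Rightarrow> 'k"
  assumes add: "\<And>y z. y \<in> Y \<Longrightarrow> z \<in> Y \<Longrightarrow> \<phi> (\<lambda>f. y f + z f) = \<phi> y + \<phi> z"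
    and mult: "\<And>c y. y \<in> Y \<Longrightarrow> \<phi> (\<lambda>f. c * y f) = c * \<phi> y"
    and bd: "\<And>y. y \<in> polar_in B Y \<Longrightarrow> norm (\<phi> y) \<le> C"
  shows "\<exists>g\<in>V. \<forall>y\<in>Y. y g = \<phi> y"
proof -
  define K where "K = max C 1"
  have K: "K \<ge> 1" "\<And>y. y \<in> polar_in B Y \<Longrightarrow> norm (\<phi> y) \<le> K" using bd by (auto simp: K_def le_max_iff_disj)
  have zero: "\<phi> (\<lambda>_. 0) = 0" using mult[OF Y_zero, of 0] by simp
  have pos: "norm (\<phi> y) \<le> K * t" if y: "y \<in> Y" and t: "t > 0" and le: "\<And>g. g \<in> B \<Longrightarrow> norm (y g) \<le> t" for y t
  proof -
    have n: "norm (of_real (inverse t) * z) = norm z / t" for z :: 'k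
      using t by (simp add: norm_mult norm_inverse field_simps norm_divide)
    have "norm (of_real (inverse t) * y g) \<le> 1" if "g \<in> B" for g
      unfolding n using le[OF that] t by simp
    then have "(\<lambda>f. of_real (inverse t) * y f) \<in> polar_in B Y"
      unfolding polar_in_def using dual_cmult[OF y, of "of_real (inverse t)"] by blast
    from K(2)[OF this] show ?thesis using t unfolding mult[OF y] n by (simp add: field_simps)
  qed
  \<comment> \<open>\<open>t = 0\<close> excludes rescaling, so \<open>pos\<close> is applied to
    \<open>t + e / K\<close> with arbitrary \<open>e > 0\<close>.\<close>
  have \<phi>_le: "norm (\<phi> y) \<le> K * t" if y: "y \<in> Y" and le: "\<And>g. g \<in> B \<Longrightarrow> norm (y g) \<le> t" for y t
  proof (rule field_le_epsilon)
    fix e :: real assume e: "e > 0"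
    have "t \<ge> 0" using le[OF zero_in_ball] norm_ge_zero order_trans by blast
    then show "norm (\<phi> y) \<le> K * t + e"
      using pos[OF y, of "t + e / K"] e K(1) le by (simp add: add_nonneg_pos add_increasing2 distrib_left)
  qed
  have \<phi>_sum: "\<phi> (\<lambda>g. \<Sum>y\<in>F. a y * y g) = (\<Sum>y\<in>F. a y * \<phi> y)" if F: "finite F" "F \<subseteq> Y" for F a
    using F
  proof (induction F)
    case (insert y F)
    have "(\<lambda>g. \<Sum>y\<in>F. a y * y g) \<in> Y"
      by (rule dual_sum_closed) (use insert Y_zero Y_add dual_cmult in auto)
    then show ?case using insert add[OF dual_cmult, of y _ "a y"] mult[of y "a y"] by simp
  qed (simp add: zero)
  have "\<exists>g\<in>B. \<forall>y\<in>Y. y g = \<phi> y / of_real K"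
  proof (rule dual_solvable)
    fix F a t assume F: "finite F" "F \<subseteq> Y" and le: "\<And>g. g \<in> B \<Longrightarrow> norm (\<Sum>y\<in>F. a y * y g) \<le> t"
    have "(\<lambda>g. \<Sum>y\<in>F. a y * y g) \<in> Y"
      by (rule dual_sum_closed) (use F Y_zero Y_add dual_cmult in auto)
    from \<phi>_le[OF this le] have le': "norm (\<Sum>y\<in>F. a y * \<phi> y) \<le> K * t" unfolding \<phi>_sum[OF F] .
    have eq: "(\<Sum>y\<in>F. a y * (\<phi> y / of_real K)) = (\<Sum>y\<in>F. a y * \<phi> y) / of_real K"
      by (simp add: sum_divide_distrib)
    show "norm (\<Sum>y\<in>F. a y * (\<phi> y / of_real K)) \<le> t"
      unfolding eq using le' K(1) by (simp add: norm_divide pos_divide_le_eq mult.commute)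
  qed simp
  then obtain g where g: "g \<in> B" "\<And>y. y \<in> Y \<Longrightarrow> y g = \<phi> y / of_real K" by blast
  show ?thesis
  proof (intro bexI ballI)
    show "fscale (*) (of_real K) g \<in> V" using g(1) by (simp add: unit_ball_def V_scale)
    fix y assume y: "y \<in> Y"
    have "y (fscale (*) (of_real K) g) = of_real K * y g" using dual_scale[OF y] g(1) ball_sub by blast
    then show "y (fscale (*) (of_real K) g) = \<phi> y" using g(2)[OF y] K(1) by simp
  qed
qed

end
section \<open>Extension of weakly extendable families\<close>

text \<open>The map \<open>fe\<close> is abstract here; the theorem instantiates it by a choice of
  scalar extensions, one for each \<open>e'\<close>.\<close>

locale weak_extension = compact_unit_ball X I s V q
  for X :: "('x \<Rightarrow> 'k::real_normed_field) set" and I :: "'i set" and s V q +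
  fixes sm :: "'k \<Rightarrow> 'e::ab_group_add \<Rightarrow> 'e" and A :: "'a set" and p G fe
  assumes E: "lc_space sm A p" and complete: "locally_complete sm A p"
    and G: "G \<subseteq> dual sm UNIV A p" and det: "determines_boundedness A p G"
    and fe: "\<And>e'. e' \<in> G \<Longrightarrow> fe e' \<in> V"
begin

definition D :: "'e set" where "D = {x. \<forall>e'\<in>G. norm (e' x) \<le> q (fe e')}"

definition weak_rep :: "(('x \<Rightarrow> 'k) \<Rightarrow> 'k) \<Rightarrow> 'e \<Rightarrow> bool" where
  "weak_rep y x \<longleftrightarrow> (\<forall>e'\<in>G. e' x = y (fe e'))"

sublocale E: vector_space sm
  using E by (simp add: lc_space_def)

lemma p_seminorm: "\<alpha> \<in> A \<Longrightarrow> seminorm_on sm UNIV (p \<alpha>)"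
  using E by (simp add: lc_space_def)

lemma p_scale: "\<alpha> \<in> A \<Longrightarrow> p \<alpha> (sm c x) = norm c * p \<alpha> x" and p_nonneg: "\<alpha> \<in> A \<Longrightarrow> 0 \<le> p \<alpha> x"
  using p_seminorm[of \<alpha>] by (auto simp: seminorm_on_def)

lemma p_zero: "\<alpha> \<in> A \<Longrightarrow> p \<alpha> 0 = 0"
  using p_scale[of \<alpha> 0 0] by simp

lemma G_add: "e' \<in> G \<Longrightarrow> e' (x + y) = e' x + e' y" and G_scale: "e' \<in> G \<Longrightarrow> e' (sm c x) = c * e' x"
  using G dual_add[of e' sm UNIV A p x y] dual_scale[of e' sm UNIV A p x c] by auto

lemma G_diff: "e' \<in> G \<Longrightarrow> e' (x - y) = e' x - e' y"
  using G_add[of e' "x - y" y] by simp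

lemma G_zero: "e' \<in> G \<Longrightarrow> e' 0 = 0"
  using G_diff[of e' 0 0] by simp

lemma bounded_if_weakly_bounded:
  "(\<And>e'. e' \<in> G \<Longrightarrow> bdd_above ((\<lambda>x. norm (e' x)) ` S)) \<Longrightarrow> bounded_sn A p S"
  using det by (simp add: determines_boundedness_def)

text \<open>The multiples of such an \<open>x\<close> are weakly bounded, hence bounded, which is
  impossible if some seminorm is positive at \<open>x\<close>.\<close>

lemma G_separates:
  assumes "\<And>e'. e' \<in> G \<Longrightarrow> e' x = 0"
  shows "x = 0"
proof (rule ccontr)
  assume "x \<noteq> 0"
  then obtain \<alpha> where \<alpha>: "\<alpha> \<in> A" "p \<alpha> x \<noteq> 0" using E unfolding lc_space_def by blast
  have "bdd_above ((\<lambda>z. norm (e' z)) ` range (\<lambda>n::nat. sm (of_nat n) x))" if "e' \<in> G" for e'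
    by (rule bdd_aboveI[of _ 0]) (auto simp: G_scale that assms)
  then have "bounded_sn A p (range (\<lambda>n::nat. sm (of_nat n) x))"
    by (rule bounded_if_weakly_bounded)
  then obtain M where M: "\<And>n. p \<alpha> (sm (of_nat n) x) \<le> M"
    using \<alpha>(1) unfolding bounded_sn_def bdd_above_def by auto
  have pos: "p \<alpha> x > 0" using \<alpha> p_nonneg[of \<alpha> x] by simp
  then obtain n where "real n * p \<alpha> x > M" using reals_Archimedean3 by blast
  then show False using M[of n] by (simp add: p_scale[OF \<alpha>(1)])
qed

lemma weak_rep_unique: "weak_rep y x \<Longrightarrow> weak_rep y x' \<Longrightarrow> x = x'"
proof -
  assume *: "weak_rep y x" "weak_rep y x'"
  have "e' (x - x') = 0" if "e' \<in> G" for e'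
    using bspec[OF *(1)[unfolded weak_rep_def] that] bspec[OF *(2)[unfolded weak_rep_def] that]
    by (simp add: G_diff that)
  then show ?thesis using G_separates[of "x - x'"] by simp
qed

lemma weak_rep_add: "weak_rep y x \<Longrightarrow> weak_rep z x' \<Longrightarrow> weak_rep (\<lambda>f. y f + z f) (x + x')"
  and weak_rep_scale: "weak_rep y x \<Longrightarrow> weak_rep (\<lambda>f. c * y f) (sm c x)"
  and weak_rep_zero: "weak_rep (\<lambda>_. 0) 0"
  by (simp_all add: weak_rep_def G_add G_scale G_zero)

text \<open>Describing the multiples of \<open>D\<close> by inequalities allows all later work with
  its gauge and span to be done functional by functional.\<close>

lemma in_scaled_D:
  assumes "t > 0"
  shows "(\<exists>d\<in>D. x = sm (of_real t) d) \<longleftrightarrow> (\<forall>e'\<in>G. norm (e' x) \<le> t * q (fe e'))"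
proof
  assume "\<exists>d\<in>D. x = sm (of_real t) d"
  then show "\<forall>e'\<in>G. norm (e' x) \<le> t * q (fe e')"
    using assms by (auto simp: D_def G_scale norm_mult)
next
  assume le: "\<forall>e'\<in>G. norm (e' x) \<le> t * q (fe e')"
  have "sm (of_real (inverse t)) x \<in> D"
    unfolding D_def
  proof (intro CollectI ballI)
    fix e' assume e': "e' \<in> G"
    have "norm (e' (sm (of_real (inverse t)) x)) = norm (e' x) / t"
      using assms by (simp add: G_scale[OF e'] norm_mult norm_inverse norm_divide divide_inverse_commute)
    then show "norm (e' (sm (of_real (inverse t)) x)) \<le> q (fe e')"
      using bspec[OF le e'] assms by (simp add: pos_divide_le_eq mult.commute)
  qed
  moreover have "x = sm (of_real t) (sm (of_real (inverse t)) x)"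
    using assms by (simp flip: of_real_mult)
  ultimately show "\<exists>d\<in>D. x = sm (of_real t) d" by blast
qed

section \<open>Local completeness applied to the disk \<open>D\<close>\<close>

lemma D_bounded: "bounded_sn A p D"
proof -
  have "bdd_above ((\<lambda>x. norm (e' x)) ` D)" if "e' \<in> G" for e'
    by (rule bdd_aboveI[of _ "q (fe e')"]) (use that in \<open>auto simp: D_def\<close>)
  then show ?thesis by (rule bounded_if_weakly_bounded)
qed

lemma D_absconv: "absconv sm D"
  unfolding absconv_def
proof (intro conjI ballI allI impI)
  have "0 \<in> D" by (simp add: D_def G_zero q_nonneg fe)
  then show "D \<noteq> {}" by blast
  fix x y and a b :: 'k assume xy: "x \<in> D" "y \<in> D" and ab: "norm a + norm b \<le> 1"
  show "sm a x + sm b y \<in> D"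
    unfolding D_def
  proof (intro CollectI ballI)
    fix e' assume e': "e' \<in> G"
    have "norm (e' (sm a x + sm b y)) \<le> norm a * norm (e' x) + norm b * norm (e' y)"
      unfolding G_add[OF e'] G_scale[OF e'] norm_mult[symmetric] by (rule norm_triangle_ineq)
    also have "\<dots> \<le> norm a * q (fe e') + norm b * q (fe e')"
      using xy e' by (intro add_mono mult_left_mono) (auto simp: D_def)
    also have "\<dots> \<le> q (fe e')"
      using mult_right_mono[OF ab q_nonneg[OF fe[OF e']]] by (simp add: distrib_right)
    finally show "norm (e' (sm a x + sm b y)) \<le> q (fe e')" .
  qed
qed

lemma D_closed: "closedin (sn_topology UNIV A p) D"
proof -
  have cl: "closedin (sn_topology UNIV A p) {x. norm (e' x) \<le> q (fe e')}" if "e' \<in> G" for e'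
  proof -
    have "continuous_map (sn_topology UNIV A p) euclidean e'"
      by (rule dual_continuous_map) (use that G p_nonneg in auto)
    then have "continuous_map (sn_topology UNIV A p) euclideanreal (\<lambda>x. norm (e' x))"
      by (rule continuous_map_norm)
    from closedin_continuous_map_preimage[OF this, of "{..q (fe e')}"] show ?thesis
      by (simp add: topspace_sn)
  qed
  have "closedin (sn_topology UNIV A p) UNIV"
    using closedin_topspace[of "sn_topology UNIV A p"] by (simp add: topspace_sn)
  \<comment> \<open>Inserting \<open>UNIV\<close> keeps the family non-empty, as
    \<open>closedin_Inter\<close> requires.\<close>
  then have "closedin (sn_topology UNIV A p) (\<Inter>(insert UNIV ((\<lambda>e'. {x. norm (e' x) \<le> q (fe e')}) ` G)))"
    using cl by (intro closedin_Inter) auto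
  moreover have "\<Inter>(insert UNIV ((\<lambda>e'. {x. norm (e' x) \<le> q (fe e')}) ` G)) = D" by (auto simp: D_def)
  ultimately show ?thesis by simp
qed

lemma D_banach: "banach_sn (span_ED sm D) (gauge sm D)"
  using complete D_closed D_bounded D_absconv unfolding locally_complete_def by blast

lemma gauge_le:
  assumes "t > 0" "\<And>e'. e' \<in> G \<Longrightarrow> norm (e' x) \<le> t * q (fe e')"
  shows "gauge sm D x \<le> t"
  unfolding gauge_def
proof (rule cInf_lower)
  show "t \<in> {t. 0 < t \<and> (\<exists>d\<in>D. x = sm (of_real t) d)}" using assms in_scaled_D by blast
  show "bdd_below {t. 0 < t \<and> (\<exists>d\<in>D. x = sm (of_real t) d)}" by (rule bdd_belowI[of _ 0]) auto
qed

text \<open>Dividing by \<open>q (fe e')\<close> gives a lower bound for all admissible factors. The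
  number \<open>t\<close> shows that such factors exist, so that \<open>Inf\<close> is a genuine
  infimum.\<close>

lemma norm_le_gauge:
  assumes t: "t > 0" "\<And>e'. e' \<in> G \<Longrightarrow> norm (e' x) \<le> t * q (fe e')" and e': "e' \<in> G"
  shows "norm (e' x) \<le> gauge sm D x * q (fe e')"
proof (cases "q (fe e') = 0")
  case True
  then show ?thesis using t(2)[OF e'] by simp
next
  case False
  then have pos: "q (fe e') > 0" using q_nonneg[OF fe[OF e']] by simp
  have "norm (e' x) / q (fe e') \<le> gauge sm D x"
    unfolding gauge_def
  proof (rule cInf_greatest)
    show "{t. 0 < t \<and> (\<exists>d\<in>D. x = sm (of_real t) d)} \<noteq> {}" using t in_scaled_D by blast
    fix r assume "r \<in> {t. 0 < t \<and> (\<exists>d\<in>D. x = sm (of_real t) d)}"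
    then have "norm (e' x) \<le> r * q (fe e')" using in_scaled_D e' by blast
    then show "norm (e' x) / q (fe e') \<le> r" using pos by (simp add: field_simps)
  qed
  then show ?thesis using pos by (simp add: field_simps)
qed

lemma span_D: "x \<in> span_ED sm D \<longleftrightarrow> (\<exists>t>0. \<forall>e'\<in>G. norm (e' x) \<le> t * q (fe e'))"
proof
  assume "x \<in> span_ED sm D"
  then obtain n d where d: "d \<in> D" "x = sm (of_nat n) d" by (auto simp: span_ED_def)
  \<comment> \<open>The extra one yields a strictly positive factor also for
    \<open>n = 0\<close>.\<close>
  have "norm (e' x) \<le> (real n + 1) * q (fe e')" if "e' \<in> G" for e'
  proof -
    have "norm (e' x) = real n * norm (e' d)" by (simp add: d G_scale that norm_mult)
    also have "\<dots> \<le> (real n + 1) * q (fe e')" using d that by (intro mult_mono) (auto simp: D_def)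
    finally show ?thesis .
  qed
  then show "\<exists>t>0. \<forall>e'\<in>G. norm (e' x) \<le> t * q (fe e')" by (intro exI[of _ "real n + 1"]) auto
next
  assume "\<exists>t>0. \<forall>e'\<in>G. norm (e' x) \<le> t * q (fe e')"
  then obtain t where t: "t > 0" "\<And>e'. e' \<in> G \<Longrightarrow> norm (e' x) \<le> t * q (fe e')" by blast
  obtain n where n: "t < real n" using reals_Archimedean2 by blast
  have "norm (e' x) \<le> real n * q (fe e')" if "e' \<in> G" for e'
    using t(2)[OF that] mult_right_mono[OF less_imp_le[OF n] q_nonneg[OF fe[OF that]]] by linarith
  then have "\<exists>d\<in>D. x = sm (of_real (real n)) d" using in_scaled_D[of "real n" x] t(1) n by auto
  then show "x \<in> span_ED sm D" by (auto simp: span_ED_def)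
qed

text \<open>This converts a uniform bound for \<open>y\<close> on \<open>B\<close> into membership
  of its representative in the corresponding multiple of \<open>D\<close>.\<close>

lemma weak_rep_le:
  assumes "y \<in> Y" "weak_rep y x" "\<And>g. g \<in> B \<Longrightarrow> norm (y g) \<le> t" "e' \<in> G"
  shows "norm (e' x) \<le> t * q (fe e')"
  using dual_le_norm[OF assms(1) fe[OF assms(4)] assms(3)] assms(2,4) by (simp add: weak_rep_def)

text \<open>Uniform closeness on \<open>B\<close> makes the representatives of the approximants
  Cauchy for the gauge of \<open>D\<close>; their limit in the Banach space spanned by
  \<open>D\<close> represents \<open>y\<close>.\<close>

lemma weak_rep_limit:
  assumes y: "y \<in> Y"
    and lim: "\<And>\<epsilon>. \<epsilon> > 0 \<Longrightarrow> \<exists>h x. h \<in> Y \<and> weak_rep h x \<and> (\<forall>g\<in>B. norm (y g - h g) \<le> \<epsilon>)"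
  shows "\<exists>x. weak_rep y x"
proof -
  define \<epsilon> where "\<epsilon> n = inverse (real (Suc n))" for n
  have \<epsilon>: "\<epsilon> n > 0" for n by (simp add: \<epsilon>_def)
  have \<epsilon>_lim: "\<epsilon> \<longlonglongrightarrow> 0" unfolding \<epsilon>_def by (rule LIMSEQ_inverse_real_of_nat)
  have "\<forall>n. \<exists>h x. h \<in> Y \<and> weak_rep h x \<and> (\<forall>g\<in>B. norm (y g - h g) \<le> \<epsilon> n)" using lim \<epsilon> by blast
  then obtain h x where h: "\<And>n. h n \<in> Y" and x: "\<And>n. weak_rep (h n) (x n)"
    and le: "\<And>n g. g \<in> B \<Longrightarrow> norm (y g - h n g) \<le> \<epsilon> n" by metis
  have x_span: "x n \<in> span_ED sm D" for n
  proof -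
    obtain t where t: "\<And>g. g \<in> B \<Longrightarrow> norm (h n g) \<le> t"
      using dual_bdd_ball[OF h[of n]] by (auto simp: bdd_above_def)
    have "norm (h n g) \<le> max t 1" if "g \<in> B" for g using t[OF that] by simp
    from weak_rep_le[OF h x this] show ?thesis
      unfolding span_D by (intro exI[of _ "max t 1"]) auto
  qed
  have cauchy: "gauge sm D (x n - x k) \<le> \<epsilon> n + \<epsilon> k" for n k
  proof (rule gauge_le)
    show "0 < \<epsilon> n + \<epsilon> k" using \<epsilon>[of n] \<epsilon>[of k] by simp
    fix e' assume e': "e' \<in> G"
    show "norm (e' (x n - x k)) \<le> (\<epsilon> n + \<epsilon> k) * q (fe e')"
    proof (rule weak_rep_le[OF _ _ _ e'])
      show "(\<lambda>f. h n f + (-1) * h k f) \<in> Y" by (intro Y_add dual_cmult h)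
      show "weak_rep (\<lambda>f. h n f + (-1) * h k f) (x n - x k)"
        using x by (simp add: weak_rep_def G_diff)
      fix g assume g: "g \<in> B"
      have "norm (h n g + (-1) * h k g) = norm ((y g - h k g) - (y g - h n g))" by simp
      also have "\<dots> \<le> \<epsilon> k + \<epsilon> n" using norm_triangle_ineq4 le[OF g] add_mono order_trans by meson
      finally show "norm (h n g + (-1) * h k g) \<le> \<epsilon> n + \<epsilon> k" by simp
    qed
  qed
  have "\<exists>N. \<forall>n\<ge>N. \<forall>k\<ge>N. gauge sm D (x n - x k) < \<delta>" if \<delta>: "\<delta> > 0" for \<delta>
  proof -
    obtain N where N: "\<And>n. n \<ge> N \<Longrightarrow> \<epsilon> n < \<delta> / 2"
      using order_tendstoD(2)[OF \<epsilon>_lim, of "\<delta> / 2"] \<delta> by (auto simp: eventually_sequentially)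
    have "gauge sm D (x n - x k) < \<delta>" if "n \<ge> N" "k \<ge> N" for n k
      using cauchy[of n k] N[OF that(1)] N[OF that(2)] by linarith
    then show ?thesis by blast
  qed
  then obtain z where z: "z \<in> span_ED sm D" and z_lim: "(\<lambda>n. gauge sm D (x n - z)) \<longlonglongrightarrow> 0"
    using D_banach x_span unfolding banach_sn_def by blast
  \<comment> \<open>Gauge convergence passes to \<open>e'\<close> by \<open>norm_le_gauge\<close>,
    and uniform convergence on \<open>B\<close> passes to the point \<open>fe e'\<close> by
    \<open>dual_le_norm\<close>.\<close>
  have "e' z = y (fe e')" if e': "e' \<in> G" for e'
  proof -
    have "norm (e' z - y (fe e')) \<le> gauge sm D (x n - z) * q (fe e') + \<epsilon> n * q (fe e')" for n
    proof -
      obtain t1 where t1: "t1 > 0" "\<And>e'. e' \<in> G \<Longrightarrow> norm (e' (x n)) \<le> t1 * q (fe e')"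
        using x_span[of n] unfolding span_D by blast
      obtain t2 where t2: "t2 > 0" "\<And>e'. e' \<in> G \<Longrightarrow> norm (e' z) \<le> t2 * q (fe e')"
        using z unfolding span_D by blast
      have "norm (e'' (x n - z)) \<le> (t1 + t2) * q (fe e'')" if "e'' \<in> G" for e''
        using norm_triangle_ineq4[of "e'' (x n)" "e'' z"] t1(2)[OF that] t2(2)[OF that]
        by (simp add: G_diff[OF that] distrib_right)
      then have 1: "norm (e' (x n - z)) \<le> gauge sm D (x n - z) * q (fe e')"
        using norm_le_gauge[of "t1 + t2" "x n - z" e'] t1(1) t2(1) e' by simp
      have 2: "norm (y (fe e') + (-1) * h n (fe e')) \<le> \<epsilon> n * q (fe e')"
      proof (rule dual_le_norm[OF _ fe[OF e']])
        show "(\<lambda>f. y f + (-1) * h n f) \<in> Y" by (intro Y_add dual_cmult h y)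
      qed (use le in simp)
      have "e' z - y (fe e') = - e' (x n - z) - (y (fe e') + (-1) * h n (fe e'))"
        using x[of n] e' by (simp add: weak_rep_def G_diff)
      then have "norm (e' z - y (fe e')) \<le> norm (e' (x n - z)) + norm (y (fe e') + (-1) * h n (fe e'))"
        by (metis norm_minus_cancel norm_triangle_ineq4)
      then show ?thesis using 1 2 by linarith
    qed
    moreover have "(\<lambda>n. gauge sm D (x n - z) * q (fe e') + \<epsilon> n * q (fe e')) \<longlonglongrightarrow> 0 * q (fe e') + 0 * q (fe e')"
      by (intro tendsto_intros z_lim \<epsilon>_lim)
    ultimately have "norm (e' z - y (fe e')) \<le> 0 * q (fe e') + 0 * q (fe e')"
      by (intro LIMSEQ_le_const) auto
    then show ?thesis by simp
  qed
  then show ?thesis unfolding weak_rep_def by blast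
qed

text \<open>The representable functionals are dense: otherwise the Helly-type theorem gives a nonzero element
  of the unit ball on which all of them vanish.\<close>
lemma weak_rep_exists:
  assumes U: "\<And>h. h \<in> U \<Longrightarrow> h \<in> Y \<and> (\<exists>x. weak_rep h x)"
    and uniq: "\<And>f. f \<in> V \<Longrightarrow> (\<And>h. h \<in> U \<Longrightarrow> h f = 0) \<Longrightarrow> f = 0"
    and y: "y \<in> Y"
  shows "\<exists>x. weak_rep y x"
proof (rule ccontr)
  assume no: "\<nexists>x. weak_rep y x"
  define P where "P = {h\<in>Y. \<exists>x. weak_rep h x}"
  have "\<not> (\<forall>\<epsilon>>0. \<exists>h x. h \<in> Y \<and> weak_rep h x \<and> (\<forall>g\<in>B. norm (y g - h g) \<le> \<epsilon>))"
    using weak_rep_limit[OF y] no by blast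
  then obtain \<epsilon> where \<epsilon>: "\<epsilon> > 0" and far: "\<And>h. h \<in> P \<Longrightarrow> \<exists>g\<in>B. norm (y g - h g) > \<epsilon>"
    unfolding P_def by (auto simp: not_le)
  have P_zero: "(\<lambda>_. 0) \<in> P" using Y_zero weak_rep_zero by (auto simp: P_def)
  have P_add: "(\<lambda>f. h f + k f) \<in> P" if "h \<in> P" "k \<in> P" for h k
    using that Y_add weak_rep_add unfolding P_def by blast
  have P_mult: "(\<lambda>f. c * h f) \<in> P" if "h \<in> P" for c h
    using that dual_cmult weak_rep_scale unfolding P_def by blast
  have y_P: "y \<notin> P" using no by (simp add: P_def)
  \<comment> \<open>These values are admissible because each element of \<open>P\<close> differs
    from \<open>y\<close> by more than \<open>\<epsilon>\<close> somewhere on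
    \<open>B\<close>.\<close>
  have "\<exists>g\<in>B. \<forall>z\<in>insert y P. z g = (if z = y then of_real \<epsilon> else 0)"
  proof (rule dual_solvable)
    show "insert y P \<subseteq> Y" using y by (auto simp: P_def)
    fix F a t assume F: "finite F" "F \<subseteq> insert y P"
      and le: "\<And>g. g \<in> B \<Longrightarrow> norm (\<Sum>z\<in>F. a z * z g) \<le> t"
    have sum: "(\<Sum>z\<in>F. a z * (if z = y then of_real \<epsilon> else 0)) = (if y \<in> F then a y * of_real \<epsilon> else 0)"
      using F(1) by (simp add: if_distrib cong: if_cong)
    have t: "0 \<le> t" using le[OF zero_in_ball] norm_ge_zero order_trans by blast
    show "norm (\<Sum>z\<in>F. a z * (if z = y then of_real \<epsilon> else 0)) \<le> t"
    proof (cases "y \<in> F \<and> a y \<noteq> 0")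
      case True
      \<comment> \<open>Dividing the combination by \<open>a y\<close> compares \<open>y\<close>
        with an element of \<open>P\<close>, so \<open>far\<close> provides a point of
        \<open>B\<close> where its norm exceeds \<open>norm (a y) * \<epsilon>\<close>.\<close>
      define h where "h = (\<lambda>g. \<Sum>z\<in>F - {y}. a z * z g)"
      have "h \<in> P" unfolding h_def by (rule dual_sum_closed) (use F P_zero P_add P_mult in auto)
      then have "(\<lambda>g. (- inverse (a y)) * h g) \<in> P" by (rule P_mult)
      then obtain g where g: "g \<in> B" "norm (y g - (- inverse (a y)) * h g) > \<epsilon>" using far by blast
      have "(\<Sum>z\<in>F. a z * z g) = a y * (y g - (- inverse (a y)) * h g)"
        using True F(1) by (simp add: h_def sum.remove[of F y] distrib_left)
      then have "norm (a y) * norm (y g - (- inverse (a y)) * h g) \<le> t"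
        using le[OF g(1)] by (simp only: norm_mult)
      moreover have "norm (a y) * \<epsilon> \<le> norm (a y) * norm (y g - (- inverse (a y)) * h g)"
        using g(2) by (intro mult_left_mono) auto
      ultimately have "norm (a y) * \<epsilon> \<le> t" by linarith
      then show ?thesis unfolding sum using True \<epsilon> by (simp add: norm_mult)
    next
      case False
      then show ?thesis unfolding sum using t by auto
    qed
  qed
  then obtain g where g: "g \<in> B" and val: "\<forall>z\<in>insert y P. z g = (if z = y then of_real \<epsilon> else 0)"
    by blast
  have yg: "y g = of_real \<epsilon>" using bspec[OF val, of y] by simp
  have gP: "h g = 0" if "h \<in> P" for h using bspec[OF val, of h] that y_P by auto
  have "g = 0"
    by (rule uniq) (use g gP U in \<open>auto simp: unit_ball_def P_def\<close>)
  then show False using yg dual_zero[OF y] \<epsilon> by simp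
qed

text \<open>Uniqueness of representatives makes \<open>u\<close> well defined and linear.
  Boundedness of \<open>D\<close> yields continuity, with \<open>B\<close> itself as the absolutely
  convex compact set, and boundedness on the polar, which \<open>u\<close> maps into
  \<open>D\<close>.\<close>

lemma weak_extension_exists:
  assumes U: "\<And>i. i \<in> U \<Longrightarrow> hf i \<in> Y \<and> weak_rep (hf i) (x0 i)"
    and uniq: "\<And>f. f \<in> V \<Longrightarrow> (\<And>i. i \<in> U \<Longrightarrow> hf i f = 0) \<Longrightarrow> f = 0"
  shows "\<exists>u\<in>eps_prod sm A p \<Omega> X I s. bounded_sn A p (u ` polar_in B Y) \<and> (\<forall>i\<in>U. u (hf i) = x0 i)"
proof -
  have ex: "\<exists>x. weak_rep y x" if "y \<in> Y" for y
    by (rule weak_rep_exists[of "hf ` U"]) (use U uniq that in auto)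
  define u where "u y = (if y \<in> Y then THE x. weak_rep y x else 0)" for y
  have u_eq: "u y = x" if "y \<in> Y" "weak_rep y x" for y x
    using that weak_rep_unique unfolding u_def by (auto intro: the_equality)
  have u: "weak_rep y (u y)" if "y \<in> Y" for y using ex[OF that] u_eq[OF that] by auto
  have "\<exists>K\<in>acx_compacts \<Omega> X I s. \<exists>C. \<forall>y\<in>Y. p \<alpha> (u y) \<le> C * Sup ((\<lambda>f. norm (y f)) ` K)" if \<alpha>: "\<alpha> \<in> A" for \<alpha>
  proof -
    obtain C where C: "\<And>x. x \<in> D \<Longrightarrow> p \<alpha> x \<le> C"
      using bspec[OF D_bounded[unfolded bounded_sn_def] \<alpha>] by (auto simp: bdd_above_def)
    have "p \<alpha> (u y) \<le> C * Sup ((\<lambda>f. norm (y f)) ` B)" if y: "y \<in> Y" for y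
    proof -
      define t where "t = Sup ((\<lambda>f. norm (y f)) ` B)"
      have le: "norm (y g) \<le> t" if "g \<in> B" for g
        unfolding t_def by (rule cSup_upper) (use that dual_bdd_ball[OF y] in auto)
      have uy: "norm (e' (u y)) \<le> t * q (fe e')" if "e' \<in> G" for e'
        by (rule weak_rep_le[OF y u[OF y] le that])
      have "t \<ge> 0" using le[OF zero_in_ball] norm_ge_zero order_trans by blast
      \<comment> \<open>The scaling description of \<open>D\<close> needs \<open>t > 0\<close>; for
        \<open>t = 0\<close> all \<open>e' (u y)\<close> vanish and separation gives
        \<open>u y = 0\<close>.\<close>
      then consider "t = 0" | "t > 0" by linarith
      then show ?thesis
      proof cases
        case 1
        then have "u y = 0" using uy by (intro G_separates) auto
        then show ?thesis using 1 p_zero[OF \<alpha>] by (simp add: t_def)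
      next
        case 2
        then obtain d where d: "d \<in> D" "u y = sm (of_real t) d" using in_scaled_D uy by blast
        then show ?thesis using C[OF d(1)] 2 by (simp add: p_scale[OF \<alpha>] t_def[symmetric] mult.commute)
      qed
    qed
    moreover have "B \<in> acx_compacts \<Omega> X I s"
      unfolding acx_compacts_def using ball_sub absconv_ball ball_compact by blast
    ultimately show ?thesis by blast
  qed
  moreover have "u (\<lambda>f. y f + z f) = u y + u z" if "y \<in> Y" "z \<in> Y" for y z
    using that by (intro u_eq Y_add weak_rep_add u)
  moreover have "u (\<lambda>f. c * y f) = sm c (u y)" if "y \<in> Y" for c y
    using that by (intro u_eq dual_cmult weak_rep_scale u)
  ultimately have "u \<in> eps_prod sm A p \<Omega> X I s" unfolding eps_prod_def by (auto simp: u_def)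
  moreover have "bounded_sn A p (u ` polar_in B Y)"
  proof -
    have "u y \<in> D" if "y \<in> polar_in B Y" for y
      using weak_rep_le[OF _ u, of y 1] that by (auto simp: D_def polar_in_def)
    then have "u ` polar_in B Y \<subseteq> D" by blast
    then show ?thesis using D_bounded unfolding bounded_sn_def by (meson bdd_above_mono image_mono)
  qed
  moreover have "\<forall>i\<in>U. u (hf i) = x0 i" using u_eq U by blast
  ultimately show ?thesis by blast
qed

end

section \<open>The image of the restriction map\<close>

theorem theorem3p19:
  fixes sm :: "'k::real_normed_field \<Rightarrow> 'e::ab_group_add \<Rightarrow> 'e"
    and A :: "'a set" and p :: "'a \<Rightarrow> 'e \<Rightarrow> real"
    and G :: "('e \<Rightarrow> 'k) set"
    and \<Omega> :: "'x set" and M :: "'m set" and M0 :: "'m set" and \<omega> :: "'m \<Rightarrow> 'x set"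
    and domE :: "'m \<Rightarrow> ('x \<Rightarrow> 'e) set" and TE :: "'m \<Rightarrow> ('x \<Rightarrow> 'e) \<Rightarrow> ('x \<Rightarrow> 'e)"
    and domK :: "'m \<Rightarrow> ('x \<Rightarrow> 'k) set" and TK :: "'m \<Rightarrow> ('x \<Rightarrow> 'k) \<Rightarrow> ('x \<Rightarrow> 'k)"
    and M1 :: "'m set" and \<nu> :: "'m \<Rightarrow> 'x \<Rightarrow> real"
    and J :: "'j set" and L :: "'l set" and Ml :: "'l \<Rightarrow> 'm set" and w :: "'j \<Rightarrow> 'l \<Rightarrow> 'm \<Rightarrow> 'x \<Rightarrow> real"
    and U :: "('m \<times> 'x) set"
  assumes E: "lc_space sm A p"
    and loc_compl: "locally_complete sm A p"
    and G_sub: "G \<subseteq> dual sm UNIV A p" and G_lin: "fun_subspace G"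
    and G_det: "determines_boundedness A p G"
    and def_V: "defining_family sm A p \<Omega> UNIV UNIV (\<lambda>_. M1) (unitw \<nu>) M M0 \<omega> domE TE domK TK"
    and strong_W: "strong_family sm A p \<Omega> J L Ml w M M0 \<omega> domE TE domK TK"
    and cons_W: "consistent_family sm A p \<Omega> J L Ml w M M0 \<omega> domE TE domK TK"
    and banach_V: "banach_sn (FVK \<Omega> UNIV UNIV (\<lambda>_. M1) (unitw \<nu>) M M0 \<omega> domK TK)
                     (snK \<Omega> (\<lambda>_. M1) (unitw \<nu>) TK ((), (), ()))"
    and BV_sub: "unit_ball (FVK \<Omega> UNIV UNIV (\<lambda>_. M1) (unitw \<nu>) M M0 \<omega> domK TK)
                     (snK \<Omega> (\<lambda>_. M1) (unitw \<nu>) TK ((), (), ()))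
                   \<subseteq> FVK \<Omega> J L Ml w M M0 \<omega> domK TK"
    and BV_cpt: "compactin (sn_topology (FVK \<Omega> J L Ml w M M0 \<omega> domK TK) (J \<times> L \<times> UNIV) (snK \<Omega> Ml w TK))
                   (unit_ball (FVK \<Omega> UNIV UNIV (\<lambda>_. M1) (unitw \<nu>) M M0 \<omega> domK TK)
                     (snK \<Omega> (\<lambda>_. M1) (unitw \<nu>) TK ((), (), ())))"
    and U_uniq: "uniqueness_set M \<omega> TK (FVK \<Omega> UNIV UNIV (\<lambda>_. M1) (unitw \<nu>) M M0 \<omega> domK TK)
                   (UNIV \<times> UNIV \<times> UNIV) (snK \<Omega> (\<lambda>_. M1) (unitw \<nu>) TK) U"
  shows "Rmap U TE ` (Sop \<Omega> (FVK \<Omega> J L Ml w M M0 \<omega> domK TK) `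
           {u \<in> eps_prod sm A p \<Omega> (FVK \<Omega> J L Ml w M M0 \<omega> domK TK) (J \<times> L \<times> UNIV) (snK \<Omega> Ml w TK).
              bounded_sn A p (u ` polar_in
                 (unit_ball (FVK \<Omega> UNIV UNIV (\<lambda>_. M1) (unitw \<nu>) M M0 \<omega> domK TK)
                    (snK \<Omega> (\<lambda>_. M1) (unitw \<nu>) TK ((), (), ())))
                 (dual (fscale (*)) (FVK \<Omega> J L Ml w M M0 \<omega> domK TK) (J \<times> L \<times> UNIV) (snK \<Omega> Ml w TK)))})
         = FVG TK (FVK \<Omega> UNIV UNIV (\<lambda>_. M1) (unitw \<nu>) M M0 \<omega> domK TK) U G"
proof -
  define V where "V = FVK \<Omega> UNIV UNIV (\<lambda>_. M1) (unitw \<nu>) M M0 \<omega> domK TK"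
  define q where "q = snK \<Omega> (\<lambda>_. M1) (unitw \<nu>) TK ((), (), ())"
  define X where "X = FVK \<Omega> J L Ml w M M0 \<omega> domK TK"
  define I where "I = J \<times> L \<times> (UNIV :: unit set)"
  define s where "s = snK \<Omega> Ml w TK"
  have wd_V: "weight_data \<Omega> (UNIV::unit set) (UNIV::unit set) (\<lambda>_. M1) (unitw \<nu>) M M0 \<omega>"
    and op: "op_data (*) \<Omega> M \<omega> domK TK"
    using def_V by (simp_all add: defining_family_def)
  have wd_W: "weight_data \<Omega> J L Ml w M M0 \<omega>" and dir_W: "directed_sn X I s"
    using cons_W by (simp_all add: consistent_family_def defining_family_def X_def I_def s_def)
  have I_ne: "I \<noteq> {}" using wd_W by (auto simp: weight_data_def I_def)
  interpret compact_unit_ball X I s V q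
  proof
    show "subspace_sm (fscale (*)) X" "\<And>i. i \<in> I \<Longrightarrow> seminorm_on (fscale (*)) X (s i)"
      unfolding X_def I_def s_def using FVK_subspace_seminorm[OF wd_W op] by blast+
    show "subspace_sm (fscale (*)) V" "seminorm_on (fscale (*)) V q"
      unfolding V_def q_def using FVK_subspace_seminorm[OF wd_V op] by blast+
    show "f = 0" if "f \<in> V" "q f = 0" for f
      using banach_V that unfolding banach_sn_def V_def q_def by blast
    show "unit_ball V q \<subseteq> X" using BV_sub unfolding V_def q_def X_def .
    show "compactin (sn_topology X I s) (unit_ball V q)"
      using BV_cpt unfolding V_def q_def X_def I_def s_def .
  qed (fact I_ne dir_W)+
  define hf where "hf = (\<lambda>(m, x). restr X (\<lambda>f. TK m f x))"
  have hf: "hf (m, x) f = TK m f x" if "f \<in> V" for m x f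
    using that V_subset by (auto simp: hf_def restr_def)
  have U_sub: "U \<subseteq> Sigma M \<omega>" using U_uniq by (simp add: uniqueness_set_def)
  have cons: "restr X (\<lambda>f. TK m f x) \<in> Y" "TE m (Sop \<Omega> X u) x = u (hf (m, x))"
    if "u \<in> eps_prod sm A p \<Omega> X I s" "(m, x) \<in> U" for u m x
    using cons_W that U_sub by (auto simp: consistent_family_def Let_def X_def I_def s_def hf_def)
  have "Rmap U TE ` (Sop \<Omega> X ` {u \<in> eps_prod sm A p \<Omega> X I s. bounded_sn A p (u ` polar_in B Y)}) = FVG TK V U G"
  proof (intro equalityI subsetI)
    fix F assume "F \<in> Rmap U TE ` (Sop \<Omega> X ` {u \<in> eps_prod sm A p \<Omega> X I s. bounded_sn A p (u ` polar_in B Y)})"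
    then obtain u where u: "u \<in> eps_prod sm A p \<Omega> X I s" and bd: "bounded_sn A p (u ` polar_in B Y)"
      and F: "F = Rmap U TE (Sop \<Omega> X u)" by blast
    have FU: "F (m, x) = u (hf (m, x))" if "(m, x) \<in> U" for m x
      using that cons(2)[OF u that] by (simp add: F Rmap_def)
    \<comment> \<open>The functional \<open>e' \<circ> u\<close> is bounded on the polar, hence
      evaluation at some \<open>g\<close> in \<open>V\<close>; testing it on
      \<open>hf (m, x)\<close> gives the required equations.\<close>
    have "\<exists>g\<in>V. \<forall>(m, x)\<in>U. TK m g x = e' (F (m, x))" if e': "e' \<in> G" for e'
    proof -
      have e'_dual: "e' \<in> dual sm UNIV A p" using e' G_sub by blast
      obtain \<alpha> C where \<alpha>: "\<alpha> \<in> A" and C: "\<And>x. norm (e' x) \<le> C * p \<alpha> x"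
        using dual_bound[OF e'_dual] by blast
      obtain K where K: "\<And>y. y \<in> polar_in B Y \<Longrightarrow> p \<alpha> (u y) \<le> K"
        using bspec[OF bd[unfolded bounded_sn_def] \<alpha>] by (auto simp: bdd_above_def)
      have p_nonneg: "0 \<le> p \<alpha> x" for x using E \<alpha> by (auto simp: lc_space_def seminorm_on_def)
      have "\<exists>g\<in>V. \<forall>y\<in>Y. y g = (e' \<circ> u) y"
      proof (rule functional_eval)
        show "(e' \<circ> u) (\<lambda>f. y f + z f) = (e' \<circ> u) y + (e' \<circ> u) z" if "y \<in> Y" "z \<in> Y" for y z
          using u that dual_add[OF e'_dual] by (simp add: eps_prod_def)
        show "(e' \<circ> u) (\<lambda>f. c * y f) = c * (e' \<circ> u) y" if "y \<in> Y" for c y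
          using u that dual_scale[OF e'_dual] by (simp add: eps_prod_def)
        show "norm ((e' \<circ> u) y) \<le> \<bar>C\<bar> * K" if y: "y \<in> polar_in B Y" for y
        proof -
          have "norm (e' (u y)) \<le> \<bar>C\<bar> * p \<alpha> (u y)"
            using C[of "u y"] mult_right_mono[OF abs_ge_self p_nonneg, of C "u y"] by linarith
          also have "\<dots> \<le> \<bar>C\<bar> * K" using K[OF y] by (intro mult_left_mono) auto
          finally show ?thesis by simp
        qed
      qed
      then obtain g where g: "g \<in> V" "\<And>y. y \<in> Y \<Longrightarrow> y g = e' (u y)" by auto
      have "TK m g x = e' (F (m, x))" if "(m, x) \<in> U" for m x
        using g(2)[OF cons(1)[OF u that]] hf[OF g(1), of m x] FU[OF that] by (simp add: hf_def)
      then show ?thesis using g(1) by blast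
    qed
    then show "F \<in> FVG TK V U G" by (auto simp: FVG_def F Rmap_def)
  next
    fix F assume F: "F \<in> FVG TK V U G"
    then have "\<forall>e'\<in>G. \<exists>g\<in>V. \<forall>(m, x)\<in>U. TK m g x = e' (F (m, x))" by (simp add: FVG_def)
    then obtain fe where fe: "\<And>e'. e' \<in> G \<Longrightarrow> fe e' \<in> V"
      and feF: "\<And>e' m x. e' \<in> G \<Longrightarrow> (m, x) \<in> U \<Longrightarrow> TK m (fe e') x = e' (F (m, x))"
      by (simp add: Ball_def Bex_def) metis
    interpret weak_extension X I s V q sm A p G fe
      by unfold_locales (fact E loc_compl G_sub G_det fe)+
    \<comment> \<open>Consistency asserts continuity of the functionals \<open>hf i\<close> only
      alongside a member of the epsilon product; the zero map provides one before \<open>u\<close>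
      is constructed.\<close>
    have "(\<lambda>_. 0) \<in> eps_prod sm A p \<Omega> X I s"
    proof -
      have "B \<in> acx_compacts \<Omega> X I s"
        unfolding acx_compacts_def using ball_sub absconv_ball ball_compact by blast
      then show ?thesis by (auto simp: eps_prod_def p_zero intro!: bexI[of _ B] exI[of _ 0])
    qed
    note hfY = cons(1)[OF this]
    have "\<exists>u\<in>eps_prod sm A p \<Omega> X I s. bounded_sn A p (u ` polar_in B Y) \<and> (\<forall>i\<in>U. u (hf i) = F i)"
    proof (rule weak_extension_exists)
      show "hf i \<in> Y \<and> weak_rep (hf i) (F i)" if "i \<in> U" for i
      proof (cases i)
        case (Pair m x)
        then show ?thesis
          using hfY[of m x] that feF hf[OF fe] by (simp add: weak_rep_def) (simp add: hf_def)
      qed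
      show "f = 0" if f: "f \<in> V" and 0: "\<And>i. i \<in> U \<Longrightarrow> hf i f = 0" for f
      proof -
        have "\<forall>(m, x)\<in>U. TK m f x = 0" using 0 hf[OF f] by auto
        then show ?thesis using U_uniq f unfolding uniqueness_set_def V_def by blast
      qed
    qed
    then obtain u where u: "u \<in> eps_prod sm A p \<Omega> X I s" "bounded_sn A p (u ` polar_in B Y)"
      and uF: "\<And>i. i \<in> U \<Longrightarrow> u (hf i) = F i" by blast
    have "F = Rmap U TE (Sop \<Omega> X u)"
    proof (rule ext, clarify)
      fix m x
      show "F (m, x) = Rmap U TE (Sop \<Omega> X u) (m, x)"
        using F uF[of "(m, x)"] cons(2)[OF u(1), of m x] by (auto simp: FVG_def Rmap_def)
    qed
    then show "F \<in> Rmap U TE ` (Sop \<Omega> X ` {u \<in> eps_prod sm A p \<Omega> X I s. bounded_sn A p (u ` polar_in B Y)})"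
      using u by blast
  qed
  then show ?thesis unfolding V_def q_def X_def I_def s_def .
qed

end
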